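(* Let $p\in\mathcal{H}_{n,d}(e)$, i.e. $p$ is a real homogeneous polynomial of degree $d$ in $n$ variables that is hyperbolic with respect to $e\in\mathbb{R}^n$. If there is a positive integer $\ell$ such that $p^\ell$ has a definite determinantal representation, then $p$ is SOS-hyperbolic with respect to $e$.
   Context: A homogeneous polynomial $p\in\mathbb{R}[x_1,\ldots,x_n]$ of degree $d$ is hyperbolic with respect to $e\in\mathbb{R}^n$ if $p(e)>0$ and for every $x\in\mathbb{R}^n$ the polynomial $t\mapsto p(x+te)$ has only real zeros; $\mathcal{H}_{n,d}(e)$ is the set of such polynomials. The hyperbolicity cone $\Lambda_+(p,e)$ is the set of $x\in\mathbb{R}^n$ such that all zeros of $t\mapsto p(te-x)$ are nonnegative. A polynomial $r\in\mathcal{H}_{n,D}(e)$ has a definite determinantal representation if there are $D\times D$ real symmetric matrices $A_1,\ldots,A_n$ with $r(x)=\det\left(\sum_{i=1}^nA_ix_i\right)$ and $\sum_{i=1}^nA_ie_i$ positive definite, where $e=(e_1,\ldots,e_n)$. (Note $p^\ell\in\mathcal{H}_{n,d\ell}(e)$.) For $x,u\in\mathbb{R}^n$ put $p_x(t)=p(x+te)$ and $D_up_x(t)=(D_up)(x+te)$, with $D_u$ the directional derivative. The parameterized Bézoutian $B_{p,e}(x)[u]$ is the $d\times d$ symmetric matrix (with entries polynomial in $x$) defined by $$\frac{p_x(t)\,D_up_x(s)-D_up_x(t)\,p_x(s)}{t-s}=\sum_{i,j=1}^d [B_{p,e}(x)[u]]_{ij}\,t^{i-1}s^{j-1}.$$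 A symmetric matrix $P(x)$ with polynomial entries is a matrix sum of squares if $P(x)=Q(x)Q(x)^T$ for some (possibly rectangular) matrix $Q$ with real polynomial entries. $p\in\mathcal{H}_{n,d}(e)$ is SOS-hyperbolic with respect to $e$ if $B_{p,e}(x)[u]$ is a matrix sum of squares for every $u\in\Lambda_+(p,e)$. *)

theory Defs
  imports "HOL-Analysis.Analysis" "Jordan_Normal_Form.Determinant"
begin

text \<open>Both libraries use the same symbol for vector components.  Points of the ambient space
  are of type \<^typ>\<open>real^'n\<close> with components \<open>x $h i\<close>; matrices whose size is a number
  are of type \<^typ>\<open>real mat\<close>.\<close>

unbundle no vec_syntax
notation vec_nth (infixl "$h" 90)

text \<open>Real polynomials in $n$ variables are identified with polynomial functions.\<close>

definition homogeneous_polynomial :: "nat \<Rightarrow> (real^'n \<Rightarrow> real) \<Rightarrow> bool" where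
  "homogeneous_polynomial d p \<longleftrightarrow>
     (\<exists>c :: ('n \<Rightarrow> nat) \<Rightarrow> real. \<forall>x.
        p x = (\<Sum>\<alpha> | (\<Sum>i\<in>UNIV. \<alpha> i) = d. c \<alpha> * (\<Prod>i\<in>UNIV. (x $h i) ^ \<alpha> i)))"

text \<open>The univariate polynomial \<open>t \<mapsto> p (x + t e)\<close>, and its set of complex zeros.\<close>

definition line_poly :: "(real^'n \<Rightarrow> real) \<Rightarrow> real^'n \<Rightarrow> real^'n \<Rightarrow> real poly" where
  "line_poly p x e = (THE q. \<forall>t. poly q t = p (x + t *\<^sub>R e))"

definition line_zeros :: "(real^'n \<Rightarrow> real) \<Rightarrow> real^'n \<Rightarrow> real^'n \<Rightarrow> complex set" where
  "line_zeros p x e = {z. poly (map_poly complex_of_real (line_poly p x e)) z = 0}"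

definition hyperbolic_polys :: "nat \<Rightarrow> real^'n \<Rightarrow> (real^'n \<Rightarrow> real) set" where
  "hyperbolic_polys d e =
     {p. homogeneous_polynomial d p \<and> p e > 0 \<and> (\<forall>x. line_zeros p x e \<subseteq> \<real>)}"

definition hyperbolicity_cone :: "(real^'n \<Rightarrow> real) \<Rightarrow> real^'n \<Rightarrow> (real^'n) set" where
  "hyperbolicity_cone p e = {x. line_zeros p (- x) e \<subseteq> \<real>\<^sub>\<ge>\<^sub>0}"

definition linear_pencil :: "nat \<Rightarrow> ('n \<Rightarrow> real mat) \<Rightarrow> real^'n \<Rightarrow> real mat" where
  "linear_pencil D A x = mat D D (\<lambda>(j, k). \<Sum>i\<in>UNIV. A i $$ (j, k) * (x $h i))"

definition pos_def_mat :: "nat \<Rightarrow> real mat \<Rightarrow> bool" where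
  "pos_def_mat D M \<longleftrightarrow> M \<in> carrier_mat D D \<and> transpose_mat M = M \<and>
     (\<forall>v\<in>carrier_vec D. v \<noteq> 0\<^sub>v D \<longrightarrow> scalar_prod v (M *\<^sub>v v) > 0)"

definition definite_det_rep :: "nat \<Rightarrow> real^'n \<Rightarrow> (real^'n \<Rightarrow> real) \<Rightarrow> bool" where
  "definite_det_rep D e r \<longleftrightarrow>
     (\<exists>A :: 'n \<Rightarrow> real mat.
        (\<forall>i. A i \<in> carrier_mat D D \<and> transpose_mat (A i) = A i) \<and>
        (\<forall>x. r x = Determinant.det (linear_pencil D A x)) \<and>
        pos_def_mat D (linear_pencil D A e))"

definition dir_deriv :: "real^'n \<Rightarrow> (real^'n \<Rightarrow> real) \<Rightarrow> real^'n \<Rightarrow> real" where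
  "dir_deriv u p x = deriv (\<lambda>h. p (x + h *\<^sub>R u)) 0"

text \<open>Rows and columns are numbered from \<open>0\<close>, so entry \<open>(i, j)\<close> belongs to $t^i s^j$.\<close>

definition bezoutian ::
  "nat \<Rightarrow> (real^'n \<Rightarrow> real) \<Rightarrow> real^'n \<Rightarrow> real^'n \<Rightarrow> real^'n \<Rightarrow> real mat" where
  "bezoutian d p e x u =
     (THE B. B \<in> carrier_mat d d \<and>
        (\<forall>t s. t \<noteq> s \<longrightarrow>
           (p (x + t *\<^sub>R e) * dir_deriv u p (x + s *\<^sub>R e)
              - dir_deriv u p (x + t *\<^sub>R e) * p (x + s *\<^sub>R e)) / (t - s)
           = (\<Sum>i<d. \<Sum>j<d. B $$ (i, j) * t ^ i * s ^ j)))"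

definition matrix_sos :: "nat \<Rightarrow> (real^'n \<Rightarrow> real mat) \<Rightarrow> bool" where
  "matrix_sos d P \<longleftrightarrow>
     (\<exists>m (Q :: real^'n \<Rightarrow> real mat).
        (\<forall>x. Q x \<in> carrier_mat d m) \<and>
        (\<forall>i<d. \<forall>j<m. real_polynomial_function (\<lambda>x. Q x $$ (i, j))) \<and>
        (\<forall>x. P x = Q x * transpose_mat (Q x)))"

definition sos_hyperbolic :: "nat \<Rightarrow> (real^'n \<Rightarrow> real) \<Rightarrow> real^'n \<Rightarrow> bool" where
  "sos_hyperbolic d p e \<longleftrightarrow> p \<in> hyperbolic_polys d e \<and>
     (\<forall>u\<in>hyperbolicity_cone p e. matrix_sos d (\<lambda>x. bezoutian d p e x u))"


text \<open>The two definite descriptions above are well defined.\<close>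

lemma line_poly_unique:
  assumes "\<And>t. poly q t = p (x + t *\<^sub>R e)"
  shows "line_poly p x e = q"
  unfolding line_poly_def using assms
  by (intro the_equality) (auto simp: poly_eq_poly_eq_iff[symmetric])

lemma prod_line_deriv:
  fixes x e u :: "real^'n" and \<alpha> :: "'n \<Rightarrow> nat"
  assumes "finite S"
  shows "\<exists>f g. degree f \<le> sum \<alpha> S \<and> degree g \<le> sum \<alpha> S \<and>
     (\<forall>t. (\<Prod>i\<in>S. ((x + t *\<^sub>R e) $h i) ^ \<alpha> i) = poly f t) \<and>
     (\<forall>t. ((\<lambda>h. \<Prod>i\<in>S. ((x + t *\<^sub>R e + h *\<^sub>R u) $h i) ^ \<alpha> i)
           has_field_derivative poly g t) (at 0))"
  using assms
proof (induction S rule: finite_induct)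
  case empty
  show ?case by (intro exI[of _ 1] exI[of _ 0]) auto
next
  case (insert i S)
  then obtain f g where fg: "degree f \<le> sum \<alpha> S" "degree g \<le> sum \<alpha> S"
    "\<And>t. (\<Prod>i\<in>S. ((x + t *\<^sub>R e) $h i) ^ \<alpha> i) = poly f t"
    "\<And>t. ((\<lambda>h. \<Prod>i\<in>S. ((x + t *\<^sub>R e + h *\<^sub>R u) $h i) ^ \<alpha> i)
           has_field_derivative poly g t) (at 0)"
    by blast
  let ?l = "[:x $h i, e $h i:]"
  let ?k = "Polynomial.smult (real (\<alpha> i) * (u $h i)) (?l ^ (\<alpha> i - 1))"
  have dl: "degree (?l ^ k) \<le> k" for k
    by (rule order.trans[OF degree_power_le]) auto
  have dk: "degree ?k \<le> \<alpha> i"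
    by (rule order.trans[OF degree_smult_le order.trans[OF dl]]) simp
  have derk: "((\<lambda>h. ((x + t *\<^sub>R e + h *\<^sub>R u) $h i) ^ \<alpha> i) has_field_derivative poly ?k t) (at 0)" for t
    by (auto intro!: derivative_eq_intros simp: algebra_simps)
  have "((\<lambda>h. ((x + t *\<^sub>R e + h *\<^sub>R u) $h i) ^ \<alpha> i *
           (\<Prod>i\<in>S. ((x + t *\<^sub>R e + h *\<^sub>R u) $h i) ^ \<alpha> i))
         has_field_derivative poly (?k * f + ?l ^ \<alpha> i * g) t) (at 0)" for t
    by (rule DERIV_cong[OF DERIV_mult[OF derk fg(4)]])
       (simp add: fg(3)[symmetric] algebra_simps)
  moreover have "degree (?k * f + ?l ^ \<alpha> i * g) \<le> \<alpha> i + sum \<alpha> S"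
    using dk dl[of "\<alpha> i"] fg(1,2)
    by (intro degree_add_le order.trans[OF degree_mult_le] add_mono) auto
  moreover have "degree (?l ^ \<alpha> i * f) \<le> \<alpha> i + sum \<alpha> S"
    using dl[of "\<alpha> i"] fg(1) by (intro order.trans[OF degree_mult_le] add_mono) auto
  moreover have "poly (?l ^ \<alpha> i * f) t = ((x + t *\<^sub>R e) $h i) ^ \<alpha> i * poly f t" for t
    by (simp add: algebra_simps)
  ultimately show ?case
    using insert.hyps fg(3)
    by (intro exI[of _ "?l ^ \<alpha> i * f"] exI[of _ "?k * f + ?l ^ \<alpha> i * g"]) (simp del: poly_mult poly_add)
qed

lemma finite_exponents: "finite {\<alpha> :: 'n::finite \<Rightarrow> nat. (\<Sum>i\<in>UNIV. \<alpha> i) = d}"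
proof (rule finite_subset)
  show "{\<alpha> :: 'n \<Rightarrow> nat. (\<Sum>i\<in>UNIV. \<alpha> i) = d} \<subseteq> PiE UNIV (\<lambda>_. {..d})"
    by (auto intro!: member_le_sum)
qed (intro finite_PiE, auto)

lemma homogeneous_polynomial_line:
  fixes x e u :: "real^'n"
  assumes "homogeneous_polynomial d p"
  obtains f g where "degree f \<le> d" "degree g \<le> d"
    "\<And>t. p (x + t *\<^sub>R e) = poly f t" "\<And>t. dir_deriv u p (x + t *\<^sub>R e) = poly g t"
proof -
  let ?M = "{\<alpha> :: 'n \<Rightarrow> nat. (\<Sum>i\<in>UNIV. \<alpha> i) = d}"
  obtain c where c: "\<And>x. p x = (\<Sum>\<alpha>\<in>?M. c \<alpha> * (\<Prod>i\<in>UNIV. (x $h i) ^ \<alpha> i))"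
    using assms unfolding homogeneous_polynomial_def by blast
  have "\<forall>\<alpha>. \<exists>f g. degree f \<le> sum \<alpha> UNIV \<and> degree g \<le> sum \<alpha> UNIV \<and>
     (\<forall>t. (\<Prod>i\<in>UNIV. ((x + t *\<^sub>R e) $h i) ^ \<alpha> i) = poly f t) \<and>
     (\<forall>t. ((\<lambda>h. \<Prod>i\<in>UNIV. ((x + t *\<^sub>R e + h *\<^sub>R u) $h i) ^ \<alpha> i)
           has_field_derivative poly g t) (at 0))"
    by (intro allI prod_line_deriv finite)
  then obtain f g where
    fg: "\<And>\<alpha>. degree (f \<alpha>) \<le> sum \<alpha> UNIV" "\<And>\<alpha>. degree (g \<alpha>) \<le> sum \<alpha> UNIV"
     "\<And>\<alpha> t. (\<Prod>i\<in>UNIV. ((x + t *\<^sub>R e) $h i) ^ \<alpha> i) = poly (f \<alpha>) t"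
     "\<And>\<alpha> t. ((\<lambda>h. \<Prod>i\<in>UNIV. ((x + t *\<^sub>R e + h *\<^sub>R u) $h i) ^ \<alpha> i)
           has_field_derivative poly (g \<alpha>) t) (at 0)"
    unfolding choice_iff by blast
  show ?thesis
  proof (rule that)
    show "degree (\<Sum>\<alpha>\<in>?M. Polynomial.smult (c \<alpha>) (f \<alpha>)) \<le> d"
      using fg(1) by (intro degree_sum_le finite_exponents order.trans[OF degree_smult_le]) auto
    show "degree (\<Sum>\<alpha>\<in>?M. Polynomial.smult (c \<alpha>) (g \<alpha>)) \<le> d"
      using fg(2) by (intro degree_sum_le finite_exponents order.trans[OF degree_smult_le]) auto
    show "p (x + t *\<^sub>R e) = poly (\<Sum>\<alpha>\<in>?M. Polynomial.smult (c \<alpha>) (f \<alpha>)) t" for t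
      by (simp only: c fg(3) poly_sum poly_smult)
    show "dir_deriv u p (x + t *\<^sub>R e) = poly (\<Sum>\<alpha>\<in>?M. Polynomial.smult (c \<alpha>) (g \<alpha>)) t" for t
      unfolding dir_deriv_def c poly_sum poly_smult
      by (intro DERIV_imp_deriv DERIV_sum DERIV_cmult fg(4))
  qed
qed

lemma poly_line_poly:
  assumes "homogeneous_polynomial d p"
  shows "poly (line_poly p x e) t = p (x + t *\<^sub>R e)"
proof -
  obtain f where "\<And>t. p (x + t *\<^sub>R e) = poly f t"
    using homogeneous_polynomial_line[OF assms, where u = 0] by blast
  thus ?thesis using line_poly_unique[of f p x e] by simp
qed

lemma bezout_monomial:
  fixes a b d :: nat
  assumes "a \<le> d" "b \<le> d"
  shows "\<exists>B :: nat \<Rightarrow> nat \<Rightarrow> real. \<forall>t s. t ^ a * s ^ b - t ^ b * s ^ a =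
    (t - s) * (\<Sum>i<d. \<Sum>j<d. B i j * t ^ i * s ^ j)"
  using assms
proof (induction a b rule: linorder_wlog)
  case (le a b)
  let ?I = "(\<lambda>k. (a + (b - a - Suc k), a + k)) ` {..<b - a}"
  have inj: "inj_on (\<lambda>k. (a + (b - a - Suc k), a + k)) {..<b - a}" by (auto simp: inj_on_def)
  have sub: "?I \<subseteq> {..<d} \<times> {..<d}" using le by auto
  have "t ^ a * s ^ b - t ^ b * s ^ a =
    (t - s) * (\<Sum>i<d. \<Sum>j<d. (if (i, j) \<in> ?I then - 1 else 0) * t ^ i * s ^ j)" for t s :: real
  proof -
    have "(\<Sum>i<d. \<Sum>j<d. (if (i, j) \<in> ?I then - 1 else 0) * t ^ i * s ^ j)
        = (\<Sum>(i, j)\<in>{..<d} \<times> {..<d}. if (i, j) \<in> ?I then - (t ^ i * s ^ j) else 0)"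
      unfolding sum.cartesian_product by (intro sum.cong) auto
    also have "\<dots> = (\<Sum>(i, j)\<in>?I. - (t ^ i * s ^ j))"
      using sub by (intro sum.mono_neutral_cong_right) auto
    also have "\<dots> = (\<Sum>k<b - a. - (t ^ (a + (b - a - Suc k)) * s ^ (a + k)))"
      by (subst sum.reindex[OF inj]) simp
    also have "\<dots> = - (t ^ a * s ^ a * (\<Sum>k<b - a. t ^ (b - a - Suc k) * s ^ k))"
      unfolding power_add sum_negf sum_distrib_left
      by (intro arg_cong[where f = uminus] sum.cong refl) (simp only: mult_ac)
    finally have *: "(\<Sum>i<d. \<Sum>j<d. (if (i, j) \<in> ?I then - 1 else 0) * t ^ i * s ^ j)
        = - (t ^ a * s ^ a * (\<Sum>k<b - a. t ^ (b - a - Suc k) * s ^ k))" .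
    have "(t - s) * (\<Sum>i<d. \<Sum>j<d. (if (i, j) \<in> ?I then - 1 else 0) * t ^ i * s ^ j)
        = t ^ a * s ^ a * (s ^ (b - a) - t ^ (b - a))"
      unfolding * power_diff_sumr2[of s "b - a" t] by (simp only: left_diff_distrib) (simp add: mult_ac right_diff_distrib)
    also have "\<dots> = t ^ a * s ^ b - t ^ b * s ^ a"
      using le(1) by (simp add: algebra_simps flip: power_add)
    finally show ?thesis by (rule sym)
  qed
  thus ?case by (intro exI[of _ "\<lambda>i j. if (i, j) \<in> ?I then - 1 else 0"] allI)
next
  case (sym a b)
  then obtain B :: "nat \<Rightarrow> nat \<Rightarrow> real" where
    B: "\<And>t s. t ^ b * s ^ a - t ^ a * s ^ b = (t - s) * (\<Sum>i<d. \<Sum>j<d. B i j * t ^ i * s ^ j)"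
    by blast
  have "t ^ a * s ^ b - t ^ b * s ^ a = (t - s) * (\<Sum>i<d. \<Sum>j<d. (- B i j) * t ^ i * s ^ j)" for t s
    using B[of t s] by (simp add: sum_negf)
  thus ?case by (intro exI[of _ "\<lambda>i j. - B i j"] allI)
qed

lemma bezout_exists:
  fixes f g :: "real poly"
  assumes "degree f \<le> d" "degree g \<le> d"
  shows "\<exists>B. \<forall>t s. poly f t * poly g s - poly g t * poly f s =
    (t - s) * (\<Sum>i<d. \<Sum>j<d. B i j * t ^ i * s ^ j)"
proof -
  have "\<forall>a b. \<exists>B :: nat \<Rightarrow> nat \<Rightarrow> real. a \<le> d \<longrightarrow> b \<le> d \<longrightarrow> (\<forall>t s. t ^ a * s ^ b - t ^ b * s ^ a =
    (t - s) * (\<Sum>i<d. \<Sum>j<d. B i j * t ^ i * s ^ j))"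
    using bezout_monomial by blast
  then obtain B :: "nat \<Rightarrow> nat \<Rightarrow> nat \<Rightarrow> nat \<Rightarrow> real" where
    B: "\<And>a b t s. a \<le> d \<Longrightarrow> b \<le> d \<Longrightarrow> t ^ a * s ^ b - t ^ b * s ^ a =
      (t - s) * (\<Sum>i<d. \<Sum>j<d. B a b i j * t ^ i * s ^ j)"
    unfolding choice_iff by blast
  have pf: "poly f t = (\<Sum>a\<le>d. coeff f a * t ^ a)" "poly g t = (\<Sum>b\<le>d. coeff g b * t ^ b)" for t
    using assms by (auto simp: poly_altdef coeff_eq_0 not_le[symmetric] intro!: sum.mono_neutral_left le_degree)
  have "poly f t * poly g s - poly g t * poly f s =
    (t - s) * (\<Sum>i<d. \<Sum>j<d. (\<Sum>a\<le>d. \<Sum>b\<le>d. coeff f a * coeff g b * B a b i j) * t ^ i * s ^ j)"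
    for t s
  proof -
    have "poly g t * poly f s = (\<Sum>a\<le>d. \<Sum>b\<le>d. coeff f a * coeff g b * (t ^ b * s ^ a))"
      unfolding pf sum_product by (subst sum.swap) (simp add: mult_ac)
    moreover have "poly f t * poly g s = (\<Sum>a\<le>d. \<Sum>b\<le>d. coeff f a * coeff g b * (t ^ a * s ^ b))"
      unfolding pf sum_product by (simp add: mult_ac)
    ultimately have "poly f t * poly g s - poly g t * poly f s
      = (\<Sum>a\<le>d. \<Sum>b\<le>d. coeff f a * coeff g b * (t ^ a * s ^ b - t ^ b * s ^ a))"
      by (simp add: sum_subtractf right_diff_distrib)
    also have "\<dots> = (\<Sum>a\<le>d. \<Sum>b\<le>d. \<Sum>i<d. \<Sum>j<d.
        (t - s) * (coeff f a * coeff g b * B a b i j * t ^ i * s ^ j))"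
      by (intro sum.cong refl, subst B) (auto simp: sum_distrib_left mult_ac)
    also have "\<dots> = (\<Sum>a\<le>d. \<Sum>i<d. \<Sum>j<d. \<Sum>b\<le>d.
        (t - s) * (coeff f a * coeff g b * B a b i j * t ^ i * s ^ j))"
      by (subst sum.swap, subst (2) sum.swap) simp
    also have "\<dots> = (\<Sum>i<d. \<Sum>j<d. \<Sum>a\<le>d. \<Sum>b\<le>d.
        (t - s) * (coeff f a * coeff g b * B a b i j * t ^ i * s ^ j))"
      by (subst sum.swap, subst (2) sum.swap) simp
    also have "\<dots> = (t - s) *
        (\<Sum>i<d. \<Sum>j<d. (\<Sum>a\<le>d. \<Sum>b\<le>d. coeff f a * coeff g b * B a b i j) * t ^ i * s ^ j)"
      by (simp add: sum_distrib_left sum_distrib_right mult_ac)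
    finally show ?thesis .
  qed
  thus ?thesis
    by (intro exI[of _ "\<lambda>i j. \<Sum>a\<le>d. \<Sum>b\<le>d. coeff f a * coeff g b * B a b i j"] allI)
qed

lemma bivariate_coeffs_unique:
  fixes B C :: "nat \<Rightarrow> nat \<Rightarrow> real"
  assumes "\<And>t s. t \<noteq> s \<Longrightarrow>
    (\<Sum>i<d. \<Sum>j<d. B i j * t ^ i * s ^ j) = (\<Sum>i<d. \<Sum>j<d. C i j * t ^ i * s ^ j)"
    and "i < d" "j < d"
  shows "B i j = C i j"
proof -
  define F where "F s = (\<Sum>i<d. monom (\<Sum>j<d. (B i j - C i j) * s ^ j) i)" for s
  have "F s = 0" for s
  proof (rule ccontr)
    assume "F s \<noteq> 0"
    hence "finite {t. poly (F s) t = 0}" by (rule poly_roots_finite)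
    moreover have "poly (F s) t = (\<Sum>i<d. \<Sum>j<d. B i j * t ^ i * s ^ j)
        - (\<Sum>i<d. \<Sum>j<d. C i j * t ^ i * s ^ j)" for t
    proof -
      have "poly (F s) t = (\<Sum>i<d. \<Sum>j<d. (B i j - C i j) * t ^ i * s ^ j)"
        by (simp add: F_def poly_sum poly_monom sum_distrib_left sum_distrib_right mult_ac)
      thus ?thesis by (simp only: left_diff_distrib sum_subtractf)
    qed
    hence "- {s} \<subseteq> {t. poly (F s) t = 0}"
      using assms(1) by auto
    ultimately have "finite (- {s})" by (rule finite_subset[rotated])
    thus False by (simp add: infinite_UNIV_char_0 Compl_eq_Diff_UNIV)
  qed
  hence "coeff (F s) i = 0" for s by simp
  hence c: "(\<Sum>j<d. (B i j - C i j) * s ^ j) = 0" for s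
    using assms(2) by (simp add: F_def coeff_sum)
  define G where "G = (\<Sum>j<d. monom (B i j - C i j) j)"
  have "poly G s = poly 0 s" for s
    using c by (simp add: G_def poly_sum poly_monom)
  hence "G = 0" by (simp add: poly_eq_poly_eq_iff[symmetric] fun_eq_iff)
  hence "coeff G j = 0" by simp
  thus ?thesis using assms(3) by (simp add: G_def coeff_sum)
qed

lemma bezoutian_welldefined:
  assumes "homogeneous_polynomial d p"
  shows "\<exists>!B. B \<in> carrier_mat d d \<and>
        (\<forall>t s. t \<noteq> s \<longrightarrow>
           (p (x + t *\<^sub>R e) * dir_deriv u p (x + s *\<^sub>R e)
              - dir_deriv u p (x + t *\<^sub>R e) * p (x + s *\<^sub>R e)) / (t - s)
           = (\<Sum>i<d. \<Sum>j<d. B $$ (i, j) * t ^ i * s ^ j))"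
    (is "\<exists>!B. ?P B")
proof -
  obtain f g where "degree f \<le> d" "degree g \<le> d"
    and fg: "\<And>t. p (x + t *\<^sub>R e) = poly f t" "\<And>t. dir_deriv u p (x + t *\<^sub>R e) = poly g t"
    using homogeneous_polynomial_line[OF assms] by metis
  then obtain B where B: "\<And>t s. poly f t * poly g s - poly g t * poly f s =
    (t - s) * (\<Sum>i<d. \<Sum>j<d. B i j * t ^ i * s ^ j)"
    using bezout_exists by blast
  show ?thesis
  proof (rule ex1I)
    show "?P (mat d d (\<lambda>(i, j). B i j))"
      by (simp add: fg B)
    show "M = mat d d (\<lambda>(i, j). B i j)" if M: "?P M" for M
    proof (rule eq_matI)
      fix i j assume "i < dim_row (mat d d (\<lambda>(i, j). B i j))" "j < dim_col (mat d d (\<lambda>(i, j). B i j))"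
      hence ij: "i < d" "j < d" by auto
      have "M $$ (i, j) = B i j"
      proof (rule bivariate_coeffs_unique[OF _ ij])
        fix t s :: real assume "t \<noteq> s"
        thus "(\<Sum>i<d. \<Sum>j<d. M $$ (i, j) * t ^ i * s ^ j) = (\<Sum>i<d. \<Sum>j<d. B i j * t ^ i * s ^ j)"
          using M by (simp add: fg B)
      qed
      thus "M $$ (i, j) = mat d d (\<lambda>(i, j). B i j) $$ (i, j)" using ij by simp
    qed (use M in auto)
  qed
qed

end

theory Submission
  imports Defs "Jordan_Normal_Form.Char_Poly"
begin

text \<open>Let \<open>p\<^sup>l\<close> be the determinant of a symmetric pencil that is positive definite at \<open>e\<close>.
  A congruence turns the value of the pencil at \<open>e\<close> into the identity, so that
  \<open>p (x + t e)\<^sup>l = c det (t I + N x)\<close> with \<open>N x\<close> symmetric and linear in \<open>x\<close>.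

  The key point is that a single factor \<open>p\<close>, instead of \<open>p\<^sup>l\<close>, already clears the
  denominators of the resolvent \<open>(t I + N x)\<^sup>-\<^sup>1\<close>.  Dividing the polynomial
  \<open>q t = p (x + t e)\<close> by \<open>t I + N x\<close> with Horner's scheme gives a quotient \<open>C x t\<close> of degree less
  than \<open>d\<close> in \<open>t\<close>, with coefficients polynomial in \<open>x\<close>, and the remainder \<open>q (- N x)\<close>.
  As \<open>q\<^sup>l\<close> is a multiple of the characteristic polynomial of \<open>- N x\<close>, the remainder is
  nilpotent (\<open>char_poly_power_nilpotent\<close>, a form of the Cayley-Hamilton theorem); being a
  real symmetric matrix, it vanishes.  Hence \<open>(t I + N x) (C x t) = p (x + t e) I\<close>.

  Differentiating the determinant yields \<open>D\<^sub>u p (x + t e) = tr (C x t N u) / l\<close>, and a resolvent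
  identity for \<open>C\<close> turns the Bezoutian form into \<open>tr (C x t C x s N u) / l\<close>.
  For \<open>u\<close> in the hyperbolicity cone \<open>N u\<close> has no negative eigenvalue, so it is positive
  semidefinite and \<open>N u = L L\<^sup>T\<close>.  The form then equals the Frobenius product of
  \<open>C x t L\<close> and \<open>C x s L\<close> divided by \<open>l\<close>, and the matrix coefficients of
  the powers of \<open>t\<close> in \<open>C x t L\<close>, written as row vectors and scaled by \<open>1 / sqrt l\<close>, are the
  rows of the required factor \<open>Q x\<close>.\<close>

section \<open>Positive semidefinite matrices\<close>

text \<open>Cholesky factorization, by elimination of the last variable.  Singular forms are included: if
  the last diagonal entry is \<open>0\<close>, then so is the whole last column, and the quotients by that
  entry take the default value \<open>0\<close>.\<close>

lemma gram_factorization: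
  fixes F :: "nat \<Rightarrow> nat \<Rightarrow> real"
  assumes "\<And>i j. i < n \<Longrightarrow> j < n \<Longrightarrow> F i j = F j i"
    and "\<And>v :: nat \<Rightarrow> real. 0 \<le> (\<Sum>i<n. \<Sum>j<n. v i * F i j * v j)"
  shows "\<exists>K :: nat \<Rightarrow> nat \<Rightarrow> real. \<forall>i<n. \<forall>j<n. F i j = (\<Sum>k<n. K i k * K j k)"
  using assms
proof (induction n arbitrary: F)
  case 0
  show ?case by simp
next
  case (Suc n F)
  define a where "a = F n n"
  have sym: "F i j = F j i" if "i \<le> n" "j \<le> n" for i j
    using Suc.prems(1)[of i j] that by simp
  have quad: "(\<Sum>i<Suc n. \<Sum>j<Suc n. v i * F i j * v j) =
      (\<Sum>i<n. \<Sum>j<n. v i * F i j * v j) + 2 * v n * (\<Sum>i<n. v i * F i n) + a * (v n)\<^sup>2" for v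
  proof -
    have "(\<Sum>j<n. v n * F n j * v j) = v n * (\<Sum>i<n. v i * F i n)"
      unfolding sum_distrib_left by (intro sum.cong refl) (simp add: sym[of n] mult_ac)
    moreover have "(\<Sum>i<n. v i * F i n * v n) = v n * (\<Sum>i<n. v i * F i n)"
      unfolding sum_distrib_left by (intro sum.cong refl) (simp add: mult_ac)
    ultimately show ?thesis
      by (simp add: sum.distrib a_def power2_eq_square algebra_simps)
  qed
  have quad_nonneg: "0 \<le> (\<Sum>i<n. \<Sum>j<n. v i * F i j * v j) + 2 * w * (\<Sum>i<n. v i * F i n) + a * w\<^sup>2"
    for v w
  proof -
    have eq: "(\<Sum>i<n. \<Sum>j<n. (v(n := w)) i * F i j * (v(n := w)) j) = (\<Sum>i<n. \<Sum>j<n. v i * F i j * v j)"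
      "(\<Sum>i<n. (v(n := w)) i * F i n) = (\<Sum>i<n. v i * F i n)"
      by (intro sum.cong refl; simp)+
    show ?thesis
      using Suc.prems(2)[of "v(n := w)"] unfolding quad eq by simp
  qed
  have a: "a \<ge> 0"
    using quad_nonneg[of "\<lambda>_. 0" 1] by simp
  have col0: "F i n = 0" if "a = 0" "i < n" for i
  proof (rule ccontr)
    assume nz: "F i n \<noteq> 0"
    have s1: "(\<Sum>k<n. (if k = i then 1 else 0) * F k n) = F i n"
      using \<open>i < n\<close> by (simp add: if_distrib[of "\<lambda>z. z * _"] cong: if_cong)
    have s2: "(\<Sum>k<n. \<Sum>j<n. (if k = i then 1 else 0) * F k j * (if j = i then 1 else 0)) = F i i"
    proof -
      have *: "(\<Sum>j<n. c * F k j * (if j = i then 1 else 0)) = c * F k i" for k and c :: real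
        using \<open>i < n\<close> by (simp add: if_distrib[of "(*) _"] cong: if_cong)
      show ?thesis
        unfolding * using \<open>i < n\<close> by (simp add: if_distrib[of "\<lambda>z. z * _"] cong: if_cong)
    qed
    have "0 \<le> F i i + 2 * w * F i n" for w
      using quad_nonneg[of "\<lambda>k. if k = i then 1 else 0" w] unfolding s1 s2 by (simp add: \<open>a = 0\<close>)
    \<comment> \<open>This value of \<open>w\<close> makes the form equal to \<open>-1\<close>.\<close>
    from this[of "- (F i i + 1) / (2 * F i n)"] nz show False
      by (simp add: field_simps)
  qed
  \<comment> \<open>The Schur complement of the last diagonal entry.\<close>
  define F' where "F' i j = F i j - F i n * F j n / a" for i j
  have "\<exists>K :: nat \<Rightarrow> nat \<Rightarrow> real. \<forall>i<n. \<forall>j<n. F' i j = (\<Sum>k<n. K i k * K j k)"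
  proof (rule Suc.IH)
    show "F' i j = F' j i" if "i < n" "j < n" for i j
      using that by (simp add: F'_def sym mult.commute)
    show "0 \<le> (\<Sum>i<n. \<Sum>j<n. v i * F' i j * v j)" for v
    proof -
      \<comment> \<open>The form of \<open>F'\<close> at \<open>v\<close> is the form of \<open>F\<close> at \<open>v\<close> extended by the minimizing
        last coordinate \<open>- b / a\<close>.\<close>
      define b where "b = (\<Sum>i<n. v i * F i n)"
      have "(\<Sum>i<n. \<Sum>j<n. v i * F' i j * v j) = (\<Sum>i<n. \<Sum>j<n. v i * F i j * v j) -
          (\<Sum>i<n. \<Sum>j<n. (v i * F i n) * (v j * F j n)) / a"
        by (simp add: F'_def sum_subtractf sum_divide_distrib algebra_simps)
      also have "(\<Sum>i<n. \<Sum>j<n. (v i * F i n) * (v j * F j n)) = b\<^sup>2"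
        by (simp add: b_def power2_eq_square sum_product)
      also have "(\<Sum>i<n. \<Sum>j<n. v i * F i j * v j) - b\<^sup>2 / a =
          (\<Sum>i<n. \<Sum>j<n. v i * F i j * v j) + 2 * (- b / a) * b + a * (- b / a)\<^sup>2"
        by (simp add: power2_eq_square field_simps)
      also have "\<dots> \<ge> 0"
        using quad_nonneg[of v "- b / a"] by (simp only: b_def)
      finally show ?thesis .
    qed
  qed
  then obtain K where K: "\<And>i j. i < n \<Longrightarrow> j < n \<Longrightarrow> F' i j = (\<Sum>k<n. K i k * K j k)"
    by blast
  define K' where "K' i k = (if k = n then F i n / sqrt a else if i = n then 0 else K i k)" for i k
  have "F i j = (\<Sum>k<Suc n. K' i k * K' j k)" if "i < Suc n" "j < Suc n" for i j
  proof -
    have last: "F i n / sqrt a * (F j n / sqrt a) = F i n * F j n / a"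
      using a by simp
    have "(\<Sum>k<n. K' i k * K' j k) = (if i = n \<or> j = n then 0 else F' i j)"
      using that by (auto simp: K'_def K less_Suc_eq)
    hence *: "(\<Sum>k<Suc n. K' i k * K' j k) = (if i = n \<or> j = n then 0 else F' i j) + F i n * F j n / a"
      using last by (simp add: K'_def)
    show ?thesis
    proof (cases "i = n \<or> j = n")
      case True
      then consider "i = n" | "j = n" by blast
      thus ?thesis
        unfolding * using True that col0[of i] col0[of j] sym[of i n] sym[of j n]
        by cases (auto simp: a_def[symmetric] less_Suc_eq)
    next
      case False
      thus ?thesis unfolding * by (simp add: F'_def)
    qed
  qed
  thus ?case by blast
qed

lemma quadratic_form_sum:
  assumes "M \<in> carrier_mat n n" "v \<in> carrier_vec n"
  shows "scalar_prod v (M *\<^sub>v v) = (\<Sum>i<n. \<Sum>j<n. v $ i * M $$ (i, j) * v $ j)"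
  using assms
  by (auto simp: scalar_prod_def sum_distrib_left mult.assoc atLeast0LessThan intro!: sum.cong)

lemma mult_mat_entry:
  assumes "A \<in> carrier_mat n m" "B \<in> carrier_mat m k" "i < n" "j < k"
  shows "(A * B) $$ (i, j) = (\<Sum>r<m. A $$ (i, r) * B $$ (r, j))"
  using assms by (auto simp: scalar_prod_def atLeast0LessThan intro!: sum.cong)

lemma psd_factorization:
  fixes M :: "real mat"
  assumes M: "M \<in> carrier_mat n n" "transpose_mat M = M"
    and psd: "\<And>v. v \<in> carrier_vec n \<Longrightarrow> 0 \<le> scalar_prod v (M *\<^sub>v v)"
  obtains K where "K \<in> carrier_mat n n" "M = K * transpose_mat K"
proof -
  have "M $$ (i, j) = M $$ (j, i)" if "i < n" "j < n" for i j
    using that M by (metis index_transpose_mat(1) carrier_matD)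
  moreover have "0 \<le> (\<Sum>i<n. \<Sum>j<n. v i * M $$ (i, j) * v j)" for v
    using psd[of "vec n v"] quadratic_form_sum[OF M(1), of "vec n v"] by simp
  ultimately obtain K where K: "\<forall>i<n. \<forall>j<n. M $$ (i, j) = (\<Sum>k<n. K i k * K j k)"
    using gram_factorization[of n "\<lambda>i j. M $$ (i, j)"] by blast
  show thesis
  proof (rule that)
    show "M = mat n n (\<lambda>(i, k). K i k) * transpose_mat (mat n n (\<lambda>(i, k). K i k))"
      using M(1) K by (intro eq_matI) (auto simp: scalar_prod_def atLeast0LessThan)
  qed simp
qed

lemma quadratic_form_bound:
  fixes M :: "real mat"
  assumes "M \<in> carrier_mat n n" "v \<in> carrier_vec n"
  shows "\<bar>scalar_prod v (M *\<^sub>v v)\<bar> \<le> (\<Sum>i<n. \<Sum>j<n. \<bar>M $$ (i, j)\<bar>) * scalar_prod v v"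
proof -
  have vv: "scalar_prod v v = (\<Sum>i<n. (v $ i)\<^sup>2)"
    using assms by (simp add: scalar_prod_def power2_eq_square atLeast0LessThan)
  have le: "\<bar>v $ i\<bar> * \<bar>v $ j\<bar> \<le> scalar_prod v v" if "i < n" "j < n" for i j
  proof -
    have "(v $ k)\<^sup>2 \<le> scalar_prod v v" if "k < n" for k
      unfolding vv using that by (intro member_le_sum) auto
    from this[OF \<open>i < n\<close>] this[OF \<open>j < n\<close>] show ?thesis
      using sum_squares_bound[of "\<bar>v $ i\<bar>" "\<bar>v $ j\<bar>"] by simp
  qed
  have "\<bar>scalar_prod v (M *\<^sub>v v)\<bar> \<le> (\<Sum>i<n. \<Sum>j<n. \<bar>v $ i * M $$ (i, j) * v $ j\<bar>)"
    unfolding quadratic_form_sum[OF assms]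
    by (rule order.trans[OF sum_abs], rule sum_mono, rule sum_abs)
  also have "\<dots> \<le> (\<Sum>i<n. \<Sum>j<n. \<bar>M $$ (i, j)\<bar> * scalar_prod v v)"
  proof (intro sum_mono)
    fix i j assume "i \<in> {..<n}" "j \<in> {..<n}"
    hence "\<bar>M $$ (i, j)\<bar> * (\<bar>v $ i\<bar> * \<bar>v $ j\<bar>) \<le> \<bar>M $$ (i, j)\<bar> * scalar_prod v v"
      by (intro mult_left_mono le) auto
    thus "\<bar>v $ i * M $$ (i, j) * v $ j\<bar> \<le> \<bar>M $$ (i, j)\<bar> * scalar_prod v v"
      by (simp add: abs_mult mult_ac)
  qed
  finally show ?thesis by (simp add: sum_distrib_right)
qed

lemma inverse_of_nonzero_det:
  fixes K :: "real mat"
  assumes K: "K \<in> carrier_mat n n" and det: "Determinant.det K \<noteq> 0"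
  obtains X where "X \<in> carrier_mat n n" "K * X = 1\<^sub>m n" "X * K = 1\<^sub>m n"
proof
  let ?X = "(1 / Determinant.det K) \<cdot>\<^sub>m adj_mat K"
  note adj = adj_mat[OF K]
  show "?X \<in> carrier_mat n n" using adj by simp
  show "K * ?X = 1\<^sub>m n"
    unfolding mult_smult_distrib[OF K adj(1)] adj(2) using det by (intro eq_matI) auto
  show "?X * K = 1\<^sub>m n"
    unfolding mult_smult_assoc_mat[OF adj(1) K] adj(3) using det by (intro eq_matI) auto
qed

lemma smult_one_mult_vec: "w \<in> carrier_vec n \<Longrightarrow> (k \<cdot>\<^sub>m 1\<^sub>m n) *\<^sub>v w = (k :: real) \<cdot>\<^sub>v w"
proof (rule eq_vecI)
  fix i assume w: "w \<in> carrier_vec n" and i: "i < dim_vec (k \<cdot>\<^sub>v w)"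
  hence "row (k \<cdot>\<^sub>m 1\<^sub>m n) i = k \<cdot>\<^sub>v unit_vec n i" by (intro eq_vecI) auto
  thus "((k \<cdot>\<^sub>m 1\<^sub>m n) *\<^sub>v w) $ i = (k \<cdot>\<^sub>v w) $ i" using w i by simp
qed simp

text \<open>A symmetric matrix without negative eigenvalues is positive semidefinite: the least
  \<open>\<epsilon> \<ge> 0\<close> for which \<open>M + \<epsilon> I\<close> is positive semidefinite cannot be positive, because a
  nonsingular positive semidefinite matrix \<open>K K\<^sup>T\<close> stays positive semidefinite under small
  perturbations.\<close>

lemma psd_of_nonsingular_shifts:
  fixes M :: "real mat"
  assumes M: "M \<in> carrier_mat n n" "transpose_mat M = M"
    and det: "\<And>\<epsilon>. \<epsilon> > 0 \<Longrightarrow> Determinant.det (M + \<epsilon> \<cdot>\<^sub>m 1\<^sub>m n) \<noteq> 0"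
    and v: "v \<in> carrier_vec n"
  shows "0 \<le> scalar_prod v (M *\<^sub>v v)"
proof -
  define q where "q w = scalar_prod w (M *\<^sub>v w)" for w
  define S where "S = {\<epsilon>. \<epsilon> \<ge> 0 \<and> (\<forall>w\<in>carrier_vec n. 0 \<le> q w + \<epsilon> * scalar_prod w w)}"
  have nonneg: "0 \<le> scalar_prod w w" for w :: "real vec"
    by (simp add: scalar_prod_def sum_nonneg)
  have shift: "scalar_prod w ((M + \<epsilon> \<cdot>\<^sub>m 1\<^sub>m n) *\<^sub>v w) = q w + \<epsilon> * scalar_prod w w"
    if w: "w \<in> carrier_vec n" for w \<epsilon>
  proof -
    have 1: "(M + \<epsilon> \<cdot>\<^sub>m 1\<^sub>m n) *\<^sub>v w = M *\<^sub>v w + \<epsilon> \<cdot>\<^sub>v w"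
      using M w by (subst add_mult_distrib_mat_vec[of _ n n]) (auto simp: smult_one_mult_vec)
    have 2: "M *\<^sub>v w \<in> carrier_vec n" using M w by simp
    show ?thesis
      unfolding 1 q_def using w 2 by (subst scalar_prod_add_distrib[of _ n]) auto
  qed
  have "0 \<le> q w + (\<Sum>i<n. \<Sum>j<n. \<bar>M $$ (i, j)\<bar>) * scalar_prod w w" if "w \<in> carrier_vec n" for w
    using quadratic_form_bound[OF M(1) that] unfolding q_def by linarith
  hence "(\<Sum>i<n. \<Sum>j<n. \<bar>M $$ (i, j)\<bar>) \<in> S"
    by (simp add: S_def sum_nonneg)
  hence ne: "S \<noteq> {}" by blast
  have bdd: "bdd_below S" by (auto simp: S_def)
  define \<epsilon> where "\<epsilon> = Inf S"
  have \<epsilon>: "\<epsilon> \<ge> 0" unfolding \<epsilon>_def by (rule cInf_greatest[OF ne]) (simp add: S_def)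
  have \<epsilon>S: "0 \<le> q w + \<epsilon> * scalar_prod w w" if w: "w \<in> carrier_vec n" for w
  proof (cases "scalar_prod w w = 0")
    case True
    with ne w show ?thesis by (auto simp: S_def)
  next
    case False
    hence pos: "scalar_prod w w > 0" using nonneg[of w] by simp
    have "- q w / scalar_prod w w \<le> \<epsilon>"
      unfolding \<epsilon>_def using pos w
      by (intro cInf_greatest[OF ne]) (auto simp: S_def field_simps)
    thus ?thesis using pos by (simp add: field_simps)
  qed
  have "\<epsilon> = 0"
  proof (rule ccontr)
    assume "\<epsilon> \<noteq> 0"
    hence \<epsilon>pos: "\<epsilon> > 0" using \<epsilon> by simp
    let ?M = "M + \<epsilon> \<cdot>\<^sub>m 1\<^sub>m n"
    have Mc: "?M \<in> carrier_mat n n" using M by simp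
    have "transpose_mat ?M = transpose_mat M + transpose_mat (\<epsilon> \<cdot>\<^sub>m 1\<^sub>m n)"
      by (rule transpose_add) (use M in auto)
    also have "\<dots> = ?M" using M by (intro eq_matI) auto
    finally have "transpose_mat ?M = ?M" .
    then obtain K where K: "K \<in> carrier_mat n n" "?M = K * transpose_mat K"
      using psd_factorization[OF Mc] \<epsilon>S shift by metis
    have Kt: "transpose_mat K \<in> carrier_mat n n" using K by simp
    have "Determinant.det (transpose_mat K) \<noteq> 0"
      using det[OF \<epsilon>pos] unfolding K(2) det_mult[OF K(1) Kt] by simp
    then obtain X where X: "X \<in> carrier_mat n n" "X * transpose_mat K = 1\<^sub>m n"
      using inverse_of_nonzero_det[OF Kt] by metis
    \<comment> \<open>With \<open>y = K\<^sup>T w\<close> one has \<open>|w|\<^sup>2 = |X y|\<^sup>2 \<le> c |y|\<^sup>2\<close>, and \<open>|y|\<^sup>2\<close> is the form of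
      \<open>M + \<epsilon> I\<close> at \<open>w\<close>; so \<open>\<epsilon>\<close> can be lowered by \<open>1 / c\<close>.\<close>
    define c where "c = (\<Sum>i<n. \<Sum>j<n. \<bar>(transpose_mat X * X) $$ (i, j)\<bar>) + 1"
    have c: "c > 0" unfolding c_def by (intro add_nonneg_pos sum_nonneg) auto
    have bound: "scalar_prod w w \<le> c * (q w + \<epsilon> * scalar_prod w w)" if w: "w \<in> carrier_vec n" for w
    proof -
      define y where "y = transpose_mat K *\<^sub>v w"
      have y: "y \<in> carrier_vec n" unfolding y_def using Kt w by simp
      have "X *\<^sub>v y = w"
        unfolding y_def using X Kt w by (simp flip: assoc_mult_mat_vec)
      have Xy: "X *\<^sub>v y \<in> carrier_vec n" using X y by simp
      have "scalar_prod w w = scalar_prod (X *\<^sub>v y) (X *\<^sub>v y)"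
        by (simp add: \<open>X *\<^sub>v y = w\<close>)
      also have "\<dots> = scalar_prod (transpose_mat X *\<^sub>v (X *\<^sub>v y)) y"
        using transpose_vec_mult_scalar[OF X(1) y Xy] by simp
      also have "\<dots> = scalar_prod y ((transpose_mat X * X) *\<^sub>v y)"
        using X y by (subst comm_scalar_prod[of _ n]) auto
      also have "\<dots> \<le> c * scalar_prod y y"
        using quadratic_form_bound[of "transpose_mat X * X" n y] X y nonneg[of y]
        by (simp add: c_def algebra_simps abs_le_iff)
      also have "scalar_prod y y = scalar_prod w (K *\<^sub>v y)"
        using transpose_vec_mult_scalar[OF K(1) y w] unfolding y_def .
      also have "K *\<^sub>v y = ?M *\<^sub>v w"
        unfolding y_def K(2) using K(1) Kt w by simp
      finally show ?thesis unfolding shift[OF w] .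
    qed
    have "max 0 (\<epsilon> - 1 / c) \<in> S"
    proof -
      have "0 \<le> q w + (\<epsilon> - 1 / c) * scalar_prod w w" if "w \<in> carrier_vec n" for w
        using bound[OF that] c by (simp add: field_simps)
      moreover have "(\<epsilon> - 1 / c) * scalar_prod w w \<le> max 0 (\<epsilon> - 1 / c) * scalar_prod w w" for w :: "real vec"
        by (intro mult_right_mono nonneg) simp
      ultimately have "0 \<le> q w + max 0 (\<epsilon> - 1 / c) * scalar_prod w w" if "w \<in> carrier_vec n" for w
        using that by (meson add_left_mono order.trans)
      thus ?thesis by (simp add: S_def)
    qed
    hence "\<epsilon> \<le> max 0 (\<epsilon> - 1 / c)" unfolding \<epsilon>_def by (rule cInf_lower[OF _ bdd])
    moreover have "1 / c > 0" using c by simp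
    ultimately show False using \<epsilon>pos by linarith
  qed
  thus ?thesis using \<epsilon>S[OF v] by (simp add: q_def)
qed

section \<open>Division of a polynomial by a symmetric matrix pencil\<close>

lemma symmetric_nilpotent_zero:
  fixes Z :: "real mat"
  assumes Z: "Z \<in> carrier_mat n n" "transpose_mat Z = Z" and "Z ^\<^sub>m Suc k = 0\<^sub>m n n"
  shows "Z = 0\<^sub>m n n"
  using assms(3)
proof (induction k)
  case 0
  thus ?case using Z by simp
next
  case (Suc k)
  \<comment> \<open>\<open>Y\<^sup>T Y = Y\<^sup>2\<close> contains the factor \<open>Z ^ (k + 2) = 0\<close>, so the columns of \<open>Y\<close> have norm
    \<open>0\<close>.\<close>
  define Y where "Y = Z ^\<^sub>m Suc k"
  have Zk: "Z ^\<^sub>m i \<in> carrier_mat n n" for i using Z by simp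
  have comm: "Z * Z ^\<^sub>m i = Z ^\<^sub>m i * Z" for i
  proof (induction i)
    case (Suc i)
    have "Z * Z ^\<^sub>m Suc i = (Z * Z ^\<^sub>m i) * Z"
      using assoc_mult_mat[OF Z(1) Zk Z(1), of i] by simp
    thus ?case using Suc by simp
  qed (use Z in simp)
  have "transpose_mat (Z ^\<^sub>m i) = Z ^\<^sub>m i" for i
  proof (induction i)
    case (Suc i)
    have "transpose_mat (Z ^\<^sub>m Suc i) = transpose_mat Z * transpose_mat (Z ^\<^sub>m i)"
      using Z Zk[of i] by (simp add: transpose_mult[of _ n n _ n])
    thus ?case using Suc Z comm by simp
  qed (use Z in simp)
  hence Yt: "transpose_mat Y = Y" by (simp only: Y_def)
  have Y: "Y \<in> carrier_mat n n" unfolding Y_def by (rule Zk)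
  have "Y * Y = Y * (Z * Z ^\<^sub>m k)" by (simp add: Y_def comm)
  also have "\<dots> = (Y * Z) * Z ^\<^sub>m k" by (rule assoc_mult_mat[OF Y Z(1) Zk, symmetric])
  also have "Y * Z = 0\<^sub>m n n" using Suc.prems by (simp add: Y_def)
  finally have YY: "Y * Y = 0\<^sub>m n n" by (simp only: left_mult_zero_mat[OF Zk])
  have "Y $$ (i, j) = 0" if ij: "i < n" "j < n" for i j
  proof -
    have sym: "Y $$ (j, r) = Y $$ (r, j)" if "r < n" for r
      using that ij Y Yt by (metis index_transpose_mat(1) carrier_matD)
    have "(\<Sum>r<n. (Y $$ (r, j))\<^sup>2) = (Y * Y) $$ (j, j)"
      unfolding mult_mat_entry[OF Y Y ij(2) ij(2)] by (intro sum.cong) (auto simp: sym power2_eq_square)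
    also have "\<dots> = 0" unfolding YY using ij by simp
    finally show ?thesis using ij by (simp add: sum_nonneg_eq_0_iff)
  qed
  hence "Y = 0\<^sub>m n n" using Y by (intro eq_matI) auto
  thus ?case unfolding Y_def by (rule Suc.IH)
qed

text \<open>Horner's scheme at the matrix \<open>B\<close>, where the coefficients \<open>a 0, a 1, \<dots>\<close> are listed from the
  leading one downwards: \<open>horner n B a m\<close> is \<open>a 0 B ^ (m - 1) + \<dots> + a (m - 1) I\<close>,
  and zero for \<open>m = 0\<close>.\<close>

fun horner :: "nat \<Rightarrow> real mat \<Rightarrow> (nat \<Rightarrow> real) \<Rightarrow> nat \<Rightarrow> real mat" where
  "horner n B a 0 = 0\<^sub>m n n"
| "horner n B a (Suc m) = a m \<cdot>\<^sub>m 1\<^sub>m n + B * horner n B a m"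

lemma horner_carrier [simp]: "B \<in> carrier_mat n n \<Longrightarrow> horner n B a m \<in> carrier_mat n n"
  by (induction m) auto

lemma horner_commute:
  assumes B: "B \<in> carrier_mat n n"
  shows "B * horner n B a m = horner n B a m * B"
proof (induction m)
  case (Suc m)
  let ?H = "horner n B a m"
  have H: "?H \<in> carrier_mat n n" using B by simp
  have "B * (a m \<cdot>\<^sub>m 1\<^sub>m n + B * ?H) = a m \<cdot>\<^sub>m B + B * (B * ?H)"
    using B H by (subst mult_add_distrib_mat[of _ n n]) (auto simp: mult_smult_distrib[of _ n n _ n])
  also have "B * (B * ?H) = (B * ?H) * B" using assoc_mult_mat[OF B H B] Suc by simp
  also have "a m \<cdot>\<^sub>m B + (B * ?H) * B = (a m \<cdot>\<^sub>m 1\<^sub>m n + B * ?H) * B"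
    using B H by (subst add_mult_distrib_mat[of _ n n]) (auto simp: mult_smult_assoc_mat[of _ n n _ n])
  finally show ?case by simp
qed (use B in simp)

lemma horner_symmetric:
  assumes B: "B \<in> carrier_mat n n" "transpose_mat B = B"
  shows "transpose_mat (horner n B a m) = horner n B a m"
proof (induction m)
  case (Suc m)
  let ?H = "horner n B a m"
  have H: "?H \<in> carrier_mat n n" using B by simp
  have "transpose_mat (B * ?H) = ?H * B"
    using B H Suc by (simp add: transpose_mult[of _ n n _ n])
  hence "transpose_mat (B * ?H) = B * ?H" using horner_commute[OF B(1)] by simp
  moreover have "transpose_mat (a m \<cdot>\<^sub>m 1\<^sub>m n) = a m \<cdot>\<^sub>m 1\<^sub>m n" by (intro eq_matI) auto
  ultimately show ?case using B H by (simp add: transpose_add[of _ n n])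
qed simp

text \<open>The quotient, with entries polynomial in \<open>t\<close>, of a polynomial of degree at most \<open>d\<close> by
  \<open>t I - B\<close>: the coefficient of \<open>t ^ k\<close> is the intermediate Horner value of index \<open>d - k\<close>.\<close>

definition horner_quotient :: "nat \<Rightarrow> real mat \<Rightarrow> (nat \<Rightarrow> real) \<Rightarrow> nat \<Rightarrow> real poly mat" where
  "horner_quotient n B a d = mat n n (\<lambda>(i, j). \<Sum>k<d. monom (horner n B a (d - k) $$ (i, j)) k)"

lemma char_poly_matrix_mult_entry:
  fixes B :: "real mat"
  assumes B: "B \<in> carrier_mat n n" and F: "F \<in> carrier_mat n n" and ij: "i < n" "j < n"
  shows "(char_poly_matrix B * F) $$ (i, j) =
    [:0, 1:] * F $$ (i, j) - (\<Sum>r<n. Polynomial.smult (B $$ (i, r)) (F $$ (r, j)))"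
proof -
  have "(char_poly_matrix B * F) $$ (i, j) = (\<Sum>r<n. char_poly_matrix B $$ (i, r) * F $$ (r, j))"
    using assms by (intro mult_mat_entry) auto
  also have "\<dots> = (\<Sum>r<n. (if r = i then [:0, 1:] * F $$ (i, j) else 0) - Polynomial.smult (B $$ (i, r)) (F $$ (r, j)))"
    using assms by (intro sum.cong) (auto simp: char_poly_matrix_def algebra_simps)
  finally show ?thesis using ij by (simp add: sum_subtractf)
qed

lemma poly_bounded_sum:
  fixes q :: "real poly"
  assumes "degree q \<le> d"
  shows "poly q t = (\<Sum>k\<le>d. coeff q k * t ^ k)"
  unfolding poly_altdef using assms
  by (intro sum.mono_neutral_left) (auto simp: coeff_eq_0)

text \<open>Division with remainder by \<open>t I - B\<close>; the remainder, the Horner value of index \<open>d + 1\<close>, is \<open>q\<close>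
  evaluated at \<open>B\<close>.\<close>

lemma horner_division:
  fixes q :: "real poly"
  assumes B: "B \<in> carrier_mat n n" and q: "degree q \<le> d"
  defines "a \<equiv> \<lambda>k. coeff q (d - k)"
  shows "q \<cdot>\<^sub>m 1\<^sub>m n = char_poly_matrix B * horner_quotient n B a d
           + map_mat (\<lambda>c. [:c:]) (horner n B a (Suc d))" (is "_ = ?L * ?C + ?Z")
proof (rule eq_matI)
  let ?H = "horner n B a"
  have C: "?C \<in> carrier_mat n n" by (simp add: horner_quotient_def)
  have H: "?H m \<in> carrier_mat n n" for m using B by simp
  show "dim_row (q \<cdot>\<^sub>m 1\<^sub>m n) = dim_row (?L * ?C + ?Z)" "dim_col (q \<cdot>\<^sub>m 1\<^sub>m n) = dim_col (?L * ?C + ?Z)"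
    using carrier_matD[OF H[of "Suc d"]] by (simp_all del: horner.simps)
  fix i j assume "i < dim_row (?L * ?C + ?Z)" "j < dim_col (?L * ?C + ?Z)"
  hence ij: "i < n" "j < n" using carrier_matD[OF H[of "Suc d"]] by (auto simp del: horner.simps)
  define \<delta> :: real where "\<delta> = (if i = j then 1 else 0)"
  have step: "(\<Sum>r<n. B $$ (i, r) * ?H m $$ (r, j)) = ?H (Suc m) $$ (i, j) - a m * \<delta>" for m
  proof -
    have "?H (Suc m) $$ (i, j) = a m * \<delta> + (B * ?H m) $$ (i, j)"
      using ij B carrier_matD[OF H[of m]] by (simp add: \<delta>_def del: index_mult_mat(1))
    thus ?thesis unfolding mult_mat_entry[OF B H ij] by simp
  qed
  have "poly ((?L * ?C + ?Z) $$ (i, j)) t = poly ((q \<cdot>\<^sub>m 1\<^sub>m n) $$ (i, j)) t" for t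
  proof -
    define h where "h k = t ^ k * ?H (Suc d - k) $$ (i, j)" for k
    have "(?L * ?C + ?Z) $$ (i, j) = (?L * ?C) $$ (i, j) + [:?H (Suc d) $$ (i, j):]"
      using ij B C carrier_matD[OF H[of "Suc d"]] by (simp del: horner.simps index_mult_mat(1))
    hence "poly ((?L * ?C + ?Z) $$ (i, j)) t = t * poly (?C $$ (i, j)) t
        - (\<Sum>r<n. B $$ (i, r) * poly (?C $$ (r, j)) t) + ?H (Suc d) $$ (i, j)"
      unfolding char_poly_matrix_mult_entry[OF B C ij] by (simp add: poly_sum del: horner.simps)
    also have "(\<Sum>r<n. B $$ (i, r) * poly (?C $$ (r, j)) t)
        = (\<Sum>r<n. \<Sum>k<d. t ^ k * (B $$ (i, r) * ?H (d - k) $$ (r, j)))"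
      using ij by (intro sum.cong refl)
        (auto simp: horner_quotient_def poly_sum poly_monom sum_distrib_left mult_ac)
    also have "\<dots> = (\<Sum>k<d. t ^ k * (\<Sum>r<n. B $$ (i, r) * ?H (d - k) $$ (r, j)))"
      by (subst sum.swap) (simp add: sum_distrib_left)
    also have "\<dots> = (\<Sum>k<d. h k - \<delta> * (coeff q k * t ^ k))"
      unfolding step h_def
      by (intro sum.cong refl) (simp add: a_def Suc_diff_le algebra_simps del: horner.simps)
    also have "t * poly (?C $$ (i, j)) t = (\<Sum>k<d. h (Suc k))"
      using ij by (auto simp: horner_quotient_def poly_sum poly_monom sum_distrib_left h_def mult_ac intro!: sum.cong)
    also have "(\<Sum>k<d. h (Suc k)) - (\<Sum>k<d. h k - \<delta> * (coeff q k * t ^ k)) + ?H (Suc d) $$ (i, j)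
        = (\<Sum>k<d. h (Suc k) - h k) + ?H (Suc d) $$ (i, j) + \<delta> * (\<Sum>k<d. coeff q k * t ^ k)"
      by (simp add: sum_subtractf sum_distrib_left del: horner.simps)
    also have "(\<Sum>k<d. h (Suc k) - h k) = h d - h 0" by (rule sum_lessThan_telescope)
    also have "h 0 = ?H (Suc d) $$ (i, j)" by (simp add: h_def del: horner.simps)
    also have "h d = \<delta> * (coeff q d * t ^ d)"
      using ij B by (simp add: h_def \<delta>_def a_def)
    also have "\<delta> * (coeff q d * t ^ d) - ?H (Suc d) $$ (i, j) + ?H (Suc d) $$ (i, j)
        + \<delta> * (\<Sum>k<d. coeff q k * t ^ k) = \<delta> * poly q t"
      unfolding poly_bounded_sum[OF q] lessThan_Suc_atMost[symmetric] by (simp add: algebra_simps)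
    also have "\<dots> = poly ((q \<cdot>\<^sub>m 1\<^sub>m n) $$ (i, j)) t"
      using ij by (simp add: \<delta>_def)
    finally show ?thesis .
  qed
  thus "(q \<cdot>\<^sub>m 1\<^sub>m n) $$ (i, j) = (?L * ?C + ?Z) $$ (i, j)"
    by (intro poly_ext) simp
qed

text \<open>A constant matrix is divisible by \<open>t I - B\<close> only if it is zero: comparing the coefficients of
  \<open>F\<close> from the top degree downwards shows that all of them vanish.\<close>

lemma char_poly_matrix_divides_constant:
  fixes B W :: "real mat"
  assumes B: "B \<in> carrier_mat n n" and W: "W \<in> carrier_mat n n" and F: "F \<in> carrier_mat n n"
    and eq: "char_poly_matrix B * F = map_mat (\<lambda>c. [:c:]) W"
  shows "W = 0\<^sub>m n n"
proof -
  have entry: "[:0, 1:] * F $$ (i, j) - (\<Sum>r<n. Polynomial.smult (B $$ (i, r)) (F $$ (r, j))) = [:W $$ (i, j):]"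
    if "i < n" "j < n" for i j
    using that W char_poly_matrix_mult_entry[OF B F that] unfolding eq by simp
  have rec: "coeff (F $$ (i, j)) k = (\<Sum>r<n. B $$ (i, r) * coeff (F $$ (r, j)) (Suc k))"
    if "i < n" "j < n" for i j k
    using arg_cong[OF entry[OF that], of "\<lambda>f. coeff f (Suc k)"] by (simp add: coeff_sum)
  have W_eq: "W $$ (i, j) = - (\<Sum>r<n. B $$ (i, r) * coeff (F $$ (r, j)) 0)" if "i < n" "j < n" for i j
    using arg_cong[OF entry[OF that], of "\<lambda>f. coeff f 0"] by (simp add: coeff_sum)
  define m where "m = Suc (Max (insert 0 ((\<lambda>ij. degree (F $$ ij)) ` ({..<n} \<times> {..<n}))))"
  have top: "coeff (F $$ (i, j)) m = 0" if "i < n" "j < n" for i j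
  proof (rule coeff_eq_0)
    have "degree (F $$ (i, j)) \<le> Max (insert 0 ((\<lambda>ij. degree (F $$ ij)) ` ({..<n} \<times> {..<n})))"
      using that by (intro Max_ge) auto
    thus "degree (F $$ (i, j)) < m" by (simp add: m_def)
  qed
  have "\<forall>i<n. \<forall>j<n. coeff (F $$ (i, j)) 0 = 0"
  proof (rule inc_induct[of 0 m])
    show "\<forall>i<n. \<forall>j<n. coeff (F $$ (i, j)) k = 0"
      if "\<forall>i<n. \<forall>j<n. coeff (F $$ (i, j)) (Suc k) = 0" for k
      using that by (auto simp: rec[where k = k])
  qed (use top in auto)
  thus ?thesis using W W_eq by (intro eq_matI) auto
qed

text \<open>A form of the Cayley-Hamilton theorem.  Taking powers of \<open>eq\<close> gives
  \<open>q ^ l I = (t I - B) S + Z ^ l\<close>, while the adjugate of \<open>t I - B\<close> shows that \<open>t I - B\<close> divides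
  \<open>q ^ l I\<close>.  Hence it divides the constant matrix \<open>Z ^ l\<close>.\<close>

lemma char_poly_power_nilpotent:
  fixes q :: "real poly"
  assumes B: "B \<in> carrier_mat n n" and C: "C \<in> carrier_mat n n" and Z: "Z \<in> carrier_mat n n"
    and eq: "q \<cdot>\<^sub>m 1\<^sub>m n = char_poly_matrix B * C + map_mat (\<lambda>c. [:c:]) Z"
    and power: "q ^ l = Polynomial.smult c (char_poly B)"
  shows "Z ^\<^sub>m l = 0\<^sub>m n n"
proof -
  let ?L = "char_poly_matrix B" and ?c = "map_mat (\<lambda>c. [:c:] :: real poly)"
  interpret lift: comm_ring_hom "\<lambda>c. [:c:] :: real poly"
    by unfold_locales (auto simp: one_pCons)
  have L: "?L \<in> carrier_mat n n" using B by simp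
  have Zk: "Z ^\<^sub>m k \<in> carrier_mat n n" "?c (Z ^\<^sub>m k) \<in> carrier_mat n n" for k using Z by auto
  have "\<exists>S\<in>carrier_mat n n. q ^ k \<cdot>\<^sub>m 1\<^sub>m n = ?L * S + ?c (Z ^\<^sub>m k)" for k
  proof (induction k)
    case 0
    have "1 \<cdot>\<^sub>m 1\<^sub>m n = ?L * 0\<^sub>m n n + ?c (1\<^sub>m n)"
      unfolding lift.mat_hom_one using L by (intro eq_matI) auto
    thus ?case using Z by (intro bexI[of _ "0\<^sub>m n n"]) auto
  next
    case (Suc k)
    then obtain S where S: "S \<in> carrier_mat n n" "q ^ k \<cdot>\<^sub>m 1\<^sub>m n = ?L * S + ?c (Z ^\<^sub>m k)" by blast
    let ?Y = "?c (Z ^\<^sub>m k)"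
    have cZ: "?c Z \<in> carrier_mat n n" using Z by simp
    have comm: "Z * Z ^\<^sub>m k = Z ^\<^sub>m k * Z"
    proof (induction k)
      case (Suc i)
      have "Z * Z ^\<^sub>m Suc i = (Z * Z ^\<^sub>m i) * Z"
        using assoc_mult_mat[OF Z Zk(1) Z, of i] by simp
      thus ?case using Suc by simp
    qed (use Z in simp)
    have "q ^ Suc k \<cdot>\<^sub>m 1\<^sub>m n = q \<cdot>\<^sub>m (q ^ k \<cdot>\<^sub>m 1\<^sub>m n)" by (intro eq_matI) auto
    also have "\<dots> = q \<cdot>\<^sub>m (?L * S) + q \<cdot>\<^sub>m ?Y"
      unfolding S(2) using L S Zk by (intro add_smult_distrib_left_mat) auto
    also have "q \<cdot>\<^sub>m ?Y = (q \<cdot>\<^sub>m 1\<^sub>m n) * ?Y"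
      by (subst mult_smult_assoc_mat[OF one_carrier_mat Zk(2)]) (simp only: left_mult_one_mat[OF Zk(2)])
    also have "\<dots> = ?L * C * ?Y + ?c Z * ?Y"
      unfolding eq using L C cZ Zk[of k] by (intro add_mult_distrib_mat) auto
    also have "?c Z * ?Y = ?c (Z ^\<^sub>m Suc k)"
      using lift.mat_hom_mult[OF Z Zk(1)[of k]] comm by simp
    also have "q \<cdot>\<^sub>m (?L * S) = ?L * (q \<cdot>\<^sub>m S)"
      using L S by (simp add: mult_smult_distrib)
    also have "?L * C * ?Y = ?L * (C * ?Y)" using L C Zk[of k] by simp
    also have "?L * (q \<cdot>\<^sub>m S) + (?L * (C * ?Y) + ?c (Z ^\<^sub>m Suc k))
        = ?L * (q \<cdot>\<^sub>m S + C * ?Y) + ?c (Z ^\<^sub>m Suc k)"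
      using L S C Zk[of k] Zk(2)[of "Suc k"]
      by (simp add: mult_add_distrib_mat[of _ n n _ n] assoc_add_mat[of _ n n] del: pow_mat.simps)
    finally show ?case
      using S C Zk(2)[of k] by (intro bexI[of _ "q \<cdot>\<^sub>m S + C * ?Y"]) auto
  qed
  then obtain S where S: "S \<in> carrier_mat n n" "q ^ l \<cdot>\<^sub>m 1\<^sub>m n = ?L * S + ?c (Z ^\<^sub>m l)" by blast
  define E where "E = [:c:] \<cdot>\<^sub>m adj_mat ?L"
  have E: "E \<in> carrier_mat n n" using adj_mat(1)[OF L] by (simp add: E_def)
  have "?L * E = q ^ l \<cdot>\<^sub>m 1\<^sub>m n"
    unfolding E_def mult_smult_distrib[OF L adj_mat(1)[OF L]] adj_mat(2)[OF L] power char_poly_def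
    by (intro eq_matI) auto
  hence "?L * (E - S) = (?L * S + ?c (Z ^\<^sub>m l)) - ?L * S"
    using L E S by (simp add: mult_minus_distrib_mat[of _ n n _ n])
  also have "\<dots> = ?c (Z ^\<^sub>m l)"
  proof -
    have "U + V - U = V" if "U \<in> carrier_mat n n" "V \<in> carrier_mat n n" for U V :: "real poly mat"
      using that by (intro eq_matI) auto
    from this[OF mult_carrier_mat[OF L S(1)] Zk(2)] show ?thesis .
  qed
  finally have "?L * (E - S) = ?c (Z ^\<^sub>m l)" .
  thus ?thesis
    by (rule char_poly_matrix_divides_constant[OF B Zk(1), rotated]) (use E S in auto)
qed

lemma horner_remainder_zero:
  fixes q :: "real poly"
  assumes B: "B \<in> carrier_mat n n" "transpose_mat B = B" and q: "degree q \<le> d"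
    and l: "l > 0" and power: "q ^ l = Polynomial.smult c (char_poly B)"
  shows "horner n B (\<lambda>k. coeff q (d - k)) (Suc d) = 0\<^sub>m n n"
proof -
  obtain k where k: "l = Suc k" using l by (cases l) auto
  note carrier = horner_carrier[OF B(1), of "\<lambda>k. coeff q (d - k)" "Suc d"]
  show ?thesis
    by (rule symmetric_nilpotent_zero[OF carrier horner_symmetric[OF B],
          OF char_poly_power_nilpotent[OF B(1) _ carrier horner_division[OF B(1) q] power[unfolded k]]])
      (simp add: horner_quotient_def)
qed

text \<open>The value of the quotient at a real number \<open>t\<close>.\<close>

definition horner_quotient_at :: "nat \<Rightarrow> real mat \<Rightarrow> (nat \<Rightarrow> real) \<Rightarrow> nat \<Rightarrow> real \<Rightarrow> real mat" where
  "horner_quotient_at n B a d t = map_mat (\<lambda>f. poly f t) (horner_quotient n B a d)"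

lemma horner_quotient_at_carrier [simp]: "horner_quotient_at n B a d t \<in> carrier_mat n n"
  by (simp add: horner_quotient_at_def horner_quotient_def)

lemma horner_quotient_at_entry:
  assumes "i < n" "j < n"
  shows "horner_quotient_at n B a d t $$ (i, j) = (\<Sum>k<d. horner n B a (d - k) $$ (i, j) * t ^ k)"
  using assms by (simp add: horner_quotient_at_def horner_quotient_def poly_sum poly_monom)

lemma horner_quotient_at_symmetric:
  assumes B: "B \<in> carrier_mat n n" "transpose_mat B = B"
  shows "transpose_mat (horner_quotient_at n B a d t) = horner_quotient_at n B a d t"
proof -
  have "horner n B a m $$ (j, i) = horner n B a m $$ (i, j)" if "i < n" "j < n" for i j m
    using that horner_symmetric[OF B, of a m] carrier_matD[OF horner_carrier[OF B(1), of a m]]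
    by (metis index_transpose_mat(1))
  thus ?thesis
    by (intro eq_matI) (auto simp: horner_quotient_at_entry carrier_matD[OF horner_quotient_at_carrier])
qed

lemma char_poly_matrix_at:
  fixes B :: "real mat"
  assumes B: "B \<in> carrier_mat n n"
  shows "map_mat (\<lambda>f. poly f t) (char_poly_matrix B) = t \<cdot>\<^sub>m 1\<^sub>m n - B"
  using B by (intro eq_matI) (auto simp: char_poly_matrix_def)

lemma poly_char_poly:
  fixes B :: "real mat"
  assumes B: "B \<in> carrier_mat n n"
  shows "poly (char_poly B) t = Determinant.det (t \<cdot>\<^sub>m 1\<^sub>m n - B)"
proof -
  have ev: "comm_ring_hom (\<lambda>f :: real poly. poly f t)"
    by unfold_locales auto
  show ?thesis
    unfolding char_poly_def char_poly_matrix_at[OF B, symmetric] by (rule comm_ring_hom.hom_det[OF ev, symmetric])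
qed

lemma horner_quotient_at_mult:
  fixes q :: "real poly"
  assumes B: "B \<in> carrier_mat n n" and q: "degree q \<le> d"
    and zero: "horner n B (\<lambda>k. coeff q (d - k)) (Suc d) = 0\<^sub>m n n"
  shows "(t \<cdot>\<^sub>m 1\<^sub>m n - B) * horner_quotient_at n B (\<lambda>k. coeff q (d - k)) d t = poly q t \<cdot>\<^sub>m 1\<^sub>m n"
proof -
  have ev: "semiring_hom (\<lambda>f :: real poly. poly f t)"
    by unfold_locales auto
  let ?C = "horner_quotient n B (\<lambda>k. coeff q (d - k)) d"
  have C: "?C \<in> carrier_mat n n" by (simp add: horner_quotient_def)
  have "q \<cdot>\<^sub>m 1\<^sub>m n = char_poly_matrix B * ?C + map_mat (\<lambda>c. [:c:]) (0\<^sub>m n n)"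
    using horner_division[OF B q] unfolding zero .
  also have "\<dots> = char_poly_matrix B * ?C" proof -
    have "map_mat (\<lambda>c. [:c:]) (0\<^sub>m n n) = (0\<^sub>m n n :: real poly mat)" by (intro eq_matI) auto
    thus ?thesis
      using right_add_zero_mat[OF mult_carrier_mat[OF char_poly_matrix_closed[OF B] C]] by simp
  qed
  finally have "map_mat (\<lambda>f. poly f t) (q \<cdot>\<^sub>m 1\<^sub>m n)
      = map_mat (\<lambda>f. poly f t) (char_poly_matrix B) * map_mat (\<lambda>f. poly f t) ?C"
    using semiring_hom.mat_hom_mult[OF ev, OF char_poly_matrix_closed[OF B] C] by simp
  moreover have "map_mat (\<lambda>f. poly f t) (q \<cdot>\<^sub>m 1\<^sub>m n) = poly q t \<cdot>\<^sub>m 1\<^sub>m n"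
    by (intro eq_matI) auto
  ultimately show ?thesis by (simp add: char_poly_matrix_at[OF B] horner_quotient_at_def)
qed

section \<open>The derivative of the determinant at the identity\<close>

text \<open>In the Leibniz expansion only the identity permutation contributes to first order, since every
  other permutation moves at least two points.\<close>

lemma DERIV_det_one_plus:
  fixes X :: "real mat"
  assumes X: "X \<in> carrier_mat n n"
  shows "((\<lambda>h. Determinant.det (1\<^sub>m n + h \<cdot>\<^sub>m X)) has_field_derivative (\<Sum>i<n. X $$ (i, i))) (at 0)"
proof -
  let ?S = "{\<pi>. \<pi> permutes {0..<n}}"
  define f :: "(nat \<Rightarrow> nat) \<Rightarrow> nat \<Rightarrow> real \<Rightarrow> real"
    where "f \<pi> i h = (if \<pi> i = i then 1 else 0) + h * X $$ (i, \<pi> i)" for \<pi> i h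
  have det: "Determinant.det (1\<^sub>m n + h \<cdot>\<^sub>m X) = (\<Sum>\<pi>\<in>?S. signof \<pi> * (\<Prod>i = 0..<n. f \<pi> i h))" for h
  proof -
    have "1\<^sub>m n + h \<cdot>\<^sub>m X \<in> carrier_mat n n" using X by simp
    moreover have "(1\<^sub>m n + h \<cdot>\<^sub>m X) $$ (i, \<pi> i) = f \<pi> i h" if "\<pi> \<in> ?S" "i \<in> {0..<n}" for \<pi> i
    proof -
      have "\<pi> i < n" using permutes_in_image[of \<pi> "{0..<n}" i] that by auto
      thus ?thesis using that X by (auto simp: f_def)
    qed
    ultimately show ?thesis by (auto simp: det_def' intro!: sum.cong prod.cong)
  qed
  have df: "(f \<pi> i has_field_derivative X $$ (i, \<pi> i)) (at 0)" for \<pi> i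
    unfolding f_def by (auto intro!: derivative_eq_intros)
  have "((\<lambda>h. \<Sum>\<pi>\<in>?S. signof \<pi> * (\<Prod>i = 0..<n. f \<pi> i h)) has_field_derivative
      (\<Sum>\<pi>\<in>?S. signof \<pi> * (\<Sum>i = 0..<n. X $$ (i, \<pi> i) * (\<Prod>k\<in>{0..<n} - {i}. f \<pi> k 0)))) (at 0)"
    by (intro DERIV_sum DERIV_cmult has_field_derivative_prod df)
  also have "(\<Sum>\<pi>\<in>?S. signof \<pi> * (\<Sum>i = 0..<n. X $$ (i, \<pi> i) * (\<Prod>k\<in>{0..<n} - {i}. f \<pi> k 0)))
      = (\<Sum>\<pi>\<in>{id}. signof \<pi> * (\<Sum>i = 0..<n. X $$ (i, \<pi> i) * (\<Prod>k\<in>{0..<n} - {i}. f \<pi> k 0)))"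
  proof (rule sum.mono_neutral_right)
    show "\<forall>\<pi>\<in>?S - {id}. signof \<pi> * (\<Sum>i = 0..<n. X $$ (i, \<pi> i) * (\<Prod>k\<in>{0..<n} - {i}. f \<pi> k 0)) = 0"
    proof
      fix \<pi> assume \<pi>: "\<pi> \<in> ?S - {id}"
      have "(\<Prod>k\<in>{0..<n} - {i}. f \<pi> k 0) = 0" for i
      proof -
        have "\<exists>k. \<pi> k \<noteq> k \<and> k \<noteq> i"
        proof (rule ccontr)
          assume "\<not> ?thesis"
          hence *: "\<pi> k = k" if "k \<noteq> i" for k using that by blast
          have "inj \<pi>" using \<pi> by (auto intro: permutes_inj)
          hence "\<pi> i = i" using * by (metis injD)
          with * have "\<pi> = id" by (metis ext id_apply)
          thus False using \<pi> by blast
        qed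
        then obtain k where k: "\<pi> k \<noteq> k" "k \<noteq> i" by blast
        moreover have "k \<in> {0..<n}" using \<pi> k(1) permutes_not_in[of \<pi> "{0..<n}" k] by auto
        ultimately show ?thesis by (intro prod_zero bexI[of _ k]) (auto simp: f_def)
      qed
      thus "signof \<pi> * (\<Sum>i = 0..<n. X $$ (i, \<pi> i) * (\<Prod>k\<in>{0..<n} - {i}. f \<pi> k 0)) = 0"
        by (simp only: mult_zero_right sum.neutral_const)
    qed
  qed (auto simp: permutes_id finite_permutations)
  also have "\<dots> = (\<Sum>i<n. X $$ (i, i))"
    by (simp add: f_def atLeast0LessThan)
  finally show ?thesis unfolding det .
qed

section \<open>Homogeneous polynomials on lines\<close>

lemma coeff_line_poly_polynomial:
  fixes p :: "real^'n \<Rightarrow> real"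
  assumes "homogeneous_polynomial d p"
  shows "real_polynomial_function (\<lambda>x. coeff (line_poly p x e) k)"
proof -
  let ?M = "{\<alpha> :: 'n \<Rightarrow> nat. (\<Sum>i\<in>UNIV. \<alpha> i) = d}"
  obtain c where c: "\<And>x. p x = (\<Sum>\<alpha>\<in>?M. c \<alpha> * (\<Prod>i\<in>UNIV. (x $h i) ^ \<alpha> i))"
    using assms unfolding homogeneous_polynomial_def by blast
  define P where "P G \<longleftrightarrow> (\<forall>k. real_polynomial_function (\<lambda>x. coeff (G x) k))"
    for G :: "real^'n \<Rightarrow> real poly"
  have P_mult: "P (\<lambda>x. F x * G x)" if "P F" "P G" for F G
    using that unfolding P_def coeff_mult
    by (auto intro!: real_polynomial_function_sum real_polynomial_function.intros(4))
  have P_1: "P (\<lambda>x. 1)" unfolding P_def by auto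
  have P_linear: "P (\<lambda>x. [:x $h i, e $h i:])" for i
    unfolding P_def
  proof
    fix k
    consider "k = 0" | "k = 1" | m where "k = Suc (Suc m)" by (metis One_nat_def nat.exhaust)
    thus "real_polynomial_function (\<lambda>x. coeff [:x $h i, e $h i:] k)"
      by cases (auto intro: real_polynomial_function.intros bounded_linear_vec_nth)
  qed
  have P_power: "P (\<lambda>x. F x ^ m)" if "P F" for F m
    by (induction m) (auto intro: P_1 P_mult that)
  have P_prod: "P (\<lambda>x. \<Prod>i\<in>I. F i x)" if "\<And>i. P (F i)" for F and I :: "'n set"
    by (induction I rule: infinite_finite_induct) (auto intro: P_1 P_mult that)
  have "line_poly p x e = (\<Sum>\<alpha>\<in>?M. Polynomial.smult (c \<alpha>) (\<Prod>i\<in>UNIV. [:x $h i, e $h i:] ^ \<alpha> i))" for x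
    by (rule line_poly_unique) (simp add: c poly_sum poly_prod mult.commute)
  moreover have "P (\<lambda>x. \<Prod>i\<in>UNIV. [:x $h i, e $h i:] ^ \<alpha> i)" for \<alpha>
    by (intro P_prod P_power P_linear)
  ultimately show ?thesis
    unfolding P_def
    by (auto simp: coeff_sum intro!: real_polynomial_function_sum real_polynomial_function.intros(4) finite_exponents)
qed

lemma degree_line_poly:
  assumes "homogeneous_polynomial d p"
  shows "degree (line_poly p x e) \<le> d"
  using homogeneous_polynomial_line[OF assms, of x e 0] line_poly_unique[of _ p x e] by metis

lemma homogeneous_polynomial_scale:
  assumes "homogeneous_polynomial d p"
  shows "p (k *\<^sub>R x) = k ^ d * p x"
proof -
  obtain c where c: "\<And>x. p x = (\<Sum>\<alpha> | (\<Sum>i\<in>UNIV. \<alpha> i) = d. c \<alpha> * (\<Prod>i\<in>UNIV. (x $h i) ^ \<alpha> i))"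
    using assms unfolding homogeneous_polynomial_def by blast
  show ?thesis
    unfolding c sum_distrib_left
    by (intro sum.cong refl) (auto simp: power_mult_distrib prod.distrib power_sum)
qed

section \<open>The Bezoutian of a normalized determinantal representation\<close>

lemma sum_split_index:
  fixes f :: "nat \<Rightarrow> nat \<Rightarrow> real"
  shows "(\<Sum>k<n * n. f (k div n) (k mod n)) = (\<Sum>a<n. \<Sum>b<n. f a b)"
proof -
  have "(\<Sum>a<n. \<Sum>b<n. f a b) = (\<Sum>(a, b)\<in>{..<n} \<times> {..<n}. f a b)"
    by (rule sum.cartesian_product)
  also have "\<dots> = (\<Sum>k<n * n. f (k div n) (k mod n))"
  proof (rule sum.reindex_bij_witness[of _ "\<lambda>k. (k div n, k mod n)" "\<lambda>(a, b). a * n + b"])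
    fix k assume "k \<in> {..<n * n}"
    moreover from this have "n > 0" by (cases n) auto
    ultimately show "(k div n, k mod n) \<in> {..<n} \<times> {..<n}"
      by (simp add: less_mult_imp_div_less)
  next
    fix ab assume "ab \<in> {..<n} \<times> {..<n}"
    then obtain a b where ab: "ab = (a, b)" "a < n" "b < n" by auto
    have "a * n + b < Suc a * n" using ab by simp
    also have "\<dots> \<le> n * n" using ab by (intro mult_le_mono1) simp
    finally show "(\<lambda>(a, b). a * n + b) ab \<in> {..<n * n}" using ab by simp
  qed auto
  finally show ?thesis by (rule sym)
qed

text \<open>A determinantal representation of \<open>p\<^sup>l\<close>, up to the constant \<open>c\<close>, by symmetric matrices
  \<open>N x\<close> of size \<open>D\<close>, normalized so that \<open>e\<close> corresponds to the identity matrix.  Linearity of \<open>N\<close>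
  is encoded by \<open>N_affine\<close>; that the entries of \<open>N\<close> are polynomials in \<open>x\<close> is recorded
  separately.\<close>

locale normalized_det_rep =
  fixes p :: "real^'n \<Rightarrow> real" and e :: "real^'n" and d l D :: nat
    and N :: "real^'n \<Rightarrow> real mat" and c :: real
  assumes homogeneous: "homogeneous_polynomial d p"
    and l_pos: "l > 0" and c_nonzero: "c \<noteq> 0"
    and N_carrier [simp]: "N x \<in> carrier_mat D D"
    and N_symmetric: "transpose_mat (N x) = N x"
    and N_affine: "N (x + h *\<^sub>R u) = N x + h \<cdot>\<^sub>m N u"
    and N_polynomial: "i < D \<Longrightarrow> j < D \<Longrightarrow> real_polynomial_function (\<lambda>x. N x $$ (i, j))"
    and det_rep: "p (x + t *\<^sub>R e) ^ l = c * Determinant.det (t \<cdot>\<^sub>m 1\<^sub>m D + N x)"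
begin

text \<open>With \<open>q t = p (x + t e)\<close>, \<open>C x t\<close> is the quotient of \<open>q\<close> by \<open>t I + N x\<close>, that is, Horner
  division at \<open>B = - N x\<close>.  The coefficient of \<open>t ^ k\<close> in it is \<open>H x (d - k)\<close>.\<close>

definition H :: "real^'n \<Rightarrow> nat \<Rightarrow> real mat" where
  "H x = horner D (- N x) (\<lambda>k. coeff (line_poly p x e) (d - k))"

definition C :: "real^'n \<Rightarrow> real \<Rightarrow> real mat" where
  "C x t = horner_quotient_at D (- N x) (\<lambda>k. coeff (line_poly p x e) (d - k)) d t"

lemma uminus_N:
  "- N x \<in> carrier_mat D D" "transpose_mat (- N x) = - N x" "t \<cdot>\<^sub>m 1\<^sub>m D - (- N x) = t \<cdot>\<^sub>m 1\<^sub>m D + N x"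
proof -
  show "t \<cdot>\<^sub>m 1\<^sub>m D - (- N x) = t \<cdot>\<^sub>m 1\<^sub>m D + N x"
    using N_carrier[of x] by (intro eq_matI) auto
qed (simp_all add: transpose_uminus N_symmetric)

lemma C_carrier [simp]: "C x t \<in> carrier_mat D D"
  by (simp add: C_def)

lemma C_symmetric: "transpose_mat (C x t) = C x t"
  unfolding C_def by (rule horner_quotient_at_symmetric[OF uminus_N(1,2)])

lemma C_entry: "i < D \<Longrightarrow> j < D \<Longrightarrow> C x t $$ (i, j) = (\<Sum>k<d. H x (d - k) $$ (i, j) * t ^ k)"
  unfolding C_def H_def by (rule horner_quotient_at_entry)

lemma H_carrier [simp]: "H x m \<in> carrier_mat D D"
  unfolding H_def by (rule horner_carrier[OF uminus_N(1)])

lemma line_poly_power: "line_poly p x e ^ l = Polynomial.smult c (char_poly (- N x))"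
  by (intro poly_ext)
    (simp add: poly_line_poly[OF homogeneous] det_rep poly_char_poly[OF uminus_N(1)] uminus_N(3))

lemma line_poly_nonzero: "line_poly p x e \<noteq> 0"
proof
  assume "line_poly p x e = 0"
  hence "char_poly (- N x) = 0"
    using line_poly_power[of x] l_pos c_nonzero by (simp add: zero_power)
  thus False using degree_monic_char_poly[OF uminus_N(1), of x] by auto
qed

text \<open>The remainder of the division vanishes, so \<open>C x t\<close> is \<open>p (x + t e)\<close> times the inverse of
  \<open>t I + N x\<close> whenever that exists.\<close>

lemma C_mult_left: "(t \<cdot>\<^sub>m 1\<^sub>m D + N x) * C x t = p (x + t *\<^sub>R e) \<cdot>\<^sub>m 1\<^sub>m D"
proof -
  note deg = degree_line_poly[OF homogeneous, of x e]
  show ?thesis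
    using horner_quotient_at_mult[OF uminus_N(1) deg
        horner_remainder_zero[OF uminus_N(1,2) deg l_pos line_poly_power], of t]
    unfolding uminus_N(3) poly_line_poly[OF homogeneous] C_def .
qed

lemma pencil_carrier: "t \<cdot>\<^sub>m 1\<^sub>m D + N x \<in> carrier_mat D D"
  by simp

lemma C_mult_right: "C x t * (t \<cdot>\<^sub>m 1\<^sub>m D + N x) = p (x + t *\<^sub>R e) \<cdot>\<^sub>m 1\<^sub>m D"
proof -
  have "transpose_mat (t \<cdot>\<^sub>m 1\<^sub>m D + N x) = transpose_mat (t \<cdot>\<^sub>m 1\<^sub>m D) + transpose_mat (N x)"
    by (rule transpose_add) auto
  also have "transpose_mat (t \<cdot>\<^sub>m 1\<^sub>m D) = t \<cdot>\<^sub>m 1\<^sub>m D" by (intro eq_matI) auto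
  finally have R: "transpose_mat (t \<cdot>\<^sub>m 1\<^sub>m D + N x) = t \<cdot>\<^sub>m 1\<^sub>m D + N x" by (simp add: N_symmetric)
  have "C x t * (t \<cdot>\<^sub>m 1\<^sub>m D + N x) = transpose_mat ((t \<cdot>\<^sub>m 1\<^sub>m D + N x) * C x t)"
    unfolding transpose_mult[OF pencil_carrier C_carrier] R C_symmetric ..
  also have "\<dots> = p (x + t *\<^sub>R e) \<cdot>\<^sub>m 1\<^sub>m D"
    unfolding C_mult_left by (intro eq_matI) auto
  finally show ?thesis .
qed

text \<open>Expand \<open>C x t ((t I + N x) - (s I + N x)) C x s\<close>.\<close>

lemma C_resolvent_identity:
  "p (x + t *\<^sub>R e) \<cdot>\<^sub>m C x s - p (x + s *\<^sub>R e) \<cdot>\<^sub>m C x t = (t - s) \<cdot>\<^sub>m (C x t * C x s)"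
proof -
  let ?R = "\<lambda>t. t \<cdot>\<^sub>m 1\<^sub>m D + N x"
  have diff: "?R t - ?R s = (t - s) \<cdot>\<^sub>m 1\<^sub>m D"
    using carrier_matD[OF N_carrier[of x]] by (intro eq_matI) (auto simp: algebra_simps)
  have 1: "p (x + t *\<^sub>R e) \<cdot>\<^sub>m C x s = C x t * (?R t * C x s)"
    using mult_smult_assoc_mat[OF one_carrier_mat C_carrier, of "p (x + t *\<^sub>R e)" x s]
    unfolding C_mult_right[symmetric] assoc_mult_mat[OF C_carrier pencil_carrier C_carrier]
    by (simp add: left_mult_one_mat[OF C_carrier])
  have 2: "p (x + s *\<^sub>R e) \<cdot>\<^sub>m C x t = C x t * (?R s * C x s)"
    unfolding C_mult_left mult_smult_distrib[OF C_carrier one_carrier_mat]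
    by (simp add: right_mult_one_mat[OF C_carrier])
  have "C x t * (?R t * C x s) - C x t * (?R s * C x s) = C x t * ((?R t - ?R s) * C x s)"
    by (simp only: mult_minus_distrib_mat[OF C_carrier mult_carrier_mat[OF pencil_carrier C_carrier]
          mult_carrier_mat[OF pencil_carrier C_carrier]]
        minus_mult_distrib_mat[OF pencil_carrier pencil_carrier C_carrier])
  also have "\<dots> = (t - s) \<cdot>\<^sub>m (C x t * C x s)"
    unfolding diff mult_smult_assoc_mat[OF one_carrier_mat C_carrier]
      mult_smult_distrib[OF C_carrier mult_carrier_mat[OF one_carrier_mat C_carrier]]
    by (simp only: left_mult_one_mat[OF C_carrier])
  finally show ?thesis unfolding 1 2 .
qed

lemma dir_deriv_trace_nonzero:
  assumes nz: "p (x + t *\<^sub>R e) \<noteq> 0"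
  shows "dir_deriv u p (x + t *\<^sub>R e) = (\<Sum>i<D. (C x t * N u) $$ (i, i)) / l"
proof -
  define y where "y = x + t *\<^sub>R e"
  let ?R = "t \<cdot>\<^sub>m 1\<^sub>m D + N x"
  define X where "X = (1 / p y) \<cdot>\<^sub>m (C x t * N u)"
  have X: "X \<in> carrier_mat D D" unfolding X_def by (intro smult_carrier_mat mult_carrier_mat[OF C_carrier N_carrier])
  have "(\<lambda>h. p (y + h *\<^sub>R u)) = poly (line_poly p y u)"
    by (simp add: fun_eq_iff poly_line_poly[OF homogeneous])
  hence df: "((\<lambda>h. p (y + h *\<^sub>R u)) has_field_derivative dir_deriv u p y) (at 0)"
    unfolding dir_deriv_def using poly_DERIV DERIV_imp_deriv by metis
  \<comment> \<open>\<open>X\<close> is the inverse of \<open>t I + N x\<close> times \<open>N u\<close>, hence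
    \<open>t I + N (x + h u) = (t I + N x) (I + h X)\<close>.\<close>
  have "?R * (h \<cdot>\<^sub>m X) = h \<cdot>\<^sub>m N u" for h
  proof -
    have "?R * X = (1 / p y) \<cdot>\<^sub>m (?R * C x t * N u)"
      unfolding X_def mult_smult_distrib[OF pencil_carrier mult_carrier_mat[OF C_carrier N_carrier]]
        assoc_mult_mat[OF pencil_carrier C_carrier N_carrier] ..
    also have "\<dots> = N u"
      unfolding C_mult_left mult_smult_assoc_mat[OF one_carrier_mat N_carrier] left_mult_one_mat[OF N_carrier]
      using nz carrier_matD[OF N_carrier[of u]] by (intro eq_matI) (auto simp: y_def)
    finally show ?thesis unfolding mult_smult_distrib[OF pencil_carrier X] by simp
  qed
  hence "t \<cdot>\<^sub>m 1\<^sub>m D + N (x + h *\<^sub>R u) = ?R * (1\<^sub>m D + h \<cdot>\<^sub>m X)" for h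
    using X by (simp add: mult_add_distrib_mat[OF pencil_carrier one_carrier_mat] N_affine
        right_mult_one_mat[OF pencil_carrier] assoc_add_mat[of _ D D])
  hence power: "p (y + h *\<^sub>R u) ^ l = p y ^ l * Determinant.det (1\<^sub>m D + h \<cdot>\<^sub>m X)" for h
    using det_rep[of "x + h *\<^sub>R u" t] det_rep[of x t] X
      det_mult[OF pencil_carrier, of "1\<^sub>m D + h \<cdot>\<^sub>m X" t x]
    by (simp add: y_def algebra_simps)
  have "((\<lambda>h. p (y + h *\<^sub>R u) ^ l) has_field_derivative (real l * p y ^ (l - 1) * dir_deriv u p y)) (at 0)"
    using DERIV_power[OF df, of l] by (simp add: mult_ac)
  moreover have "((\<lambda>h. p (y + h *\<^sub>R u) ^ l) has_field_derivative p y ^ l * (\<Sum>i<D. X $$ (i, i))) (at 0)"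
    unfolding power by (intro DERIV_cmult DERIV_det_one_plus X)
  ultimately have "real l * p y ^ (l - 1) * dir_deriv u p y = p y ^ l * (\<Sum>i<D. X $$ (i, i))"
    by (rule DERIV_unique)
  also have "p y ^ l = p y ^ (l - 1) * p y"
    using l_pos by (cases l) auto
  also have "(\<Sum>i<D. X $$ (i, i)) = (\<Sum>i<D. (C x t * N u) $$ (i, i)) / p y"
    using carrier_matD[OF C_carrier[of x t]] carrier_matD[OF N_carrier[of u]]
    by (simp add: X_def sum_divide_distrib del: index_mult_mat(1))
  finally show ?thesis
    using nz l_pos by (simp add: y_def field_simps)
qed

text \<open>Both sides are polynomials in \<open>t\<close>, so the zeros of \<open>p (x + t e)\<close> need not be excluded.\<close>

lemma dir_deriv_trace:
  "dir_deriv u p (x + t *\<^sub>R e) = (\<Sum>i<D. (C x t * N u) $$ (i, i)) / l"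
proof -
  let ?q = "line_poly p x e"
  obtain g where g: "\<And>t. dir_deriv u p (x + t *\<^sub>R e) = poly g t"
    by (rule homogeneous_polynomial_line[OF homogeneous, of x e u]) (rule that)
  define g' where "g' = Polynomial.smult (1 / l)
    (\<Sum>i<D. \<Sum>r<D. Polynomial.smult (N u $$ (r, i)) (\<Sum>k<d. monom (H x (d - k) $$ (i, r)) k))"
  have g': "(\<Sum>i<D. (C x t * N u) $$ (i, i)) / l = poly g' t" for t
    by (simp add: g'_def poly_sum poly_monom mult_mat_entry[OF C_carrier N_carrier] C_entry mult.commute
        del: index_mult_mat(1))
  have "?q * (g - g') = 0"
  proof (intro poly_ext)
    fix t
    show "poly (?q * (g - g')) t = poly 0 t"
      using dir_deriv_trace_nonzero[of x t u]
      unfolding g g' poly_mult poly_diff poly_line_poly[OF homogeneous] by auto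
  qed
  hence "g = g'" using line_poly_nonzero by simp
  thus ?thesis by (simp only: g g')
qed

lemma bezout_trace:
  "p (x + t *\<^sub>R e) * dir_deriv u p (x + s *\<^sub>R e) - dir_deriv u p (x + t *\<^sub>R e) * p (x + s *\<^sub>R e)
    = (t - s) * (\<Sum>i<D. (C x t * C x s * N u) $$ (i, i)) / l"
proof -
  let ?a = "p (x + t *\<^sub>R e)" and ?b = "p (x + s *\<^sub>R e)"
  note N = carrier_matD[OF N_carrier] and C = carrier_matD[OF C_carrier]
  have "(t - s) \<cdot>\<^sub>m (C x t * C x s * N u) = (t - s) \<cdot>\<^sub>m (C x t * C x s) * N u"
    by (simp only: mult_smult_assoc_mat[OF mult_carrier_mat[OF C_carrier C_carrier] N_carrier])
  also have "\<dots> = ?a \<cdot>\<^sub>m (C x s * N u) - ?b \<cdot>\<^sub>m (C x t * N u)"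
    unfolding C_resolvent_identity[symmetric]
      minus_mult_distrib_mat[OF smult_carrier_mat[OF C_carrier] smult_carrier_mat[OF C_carrier] N_carrier]
      mult_smult_assoc_mat[OF C_carrier N_carrier] ..
  finally have eq: "(t - s) \<cdot>\<^sub>m (C x t * C x s * N u) = ?a \<cdot>\<^sub>m (C x s * N u) - ?b \<cdot>\<^sub>m (C x t * N u)" .
  have "(t - s) * (C x t * C x s * N u) $$ (i, i) = ?a * (C x s * N u) $$ (i, i) - ?b * (C x t * N u) $$ (i, i)"
    if "i < D" for i
    using arg_cong[OF eq, of "\<lambda>M. M $$ (i, i)"] that by (simp add: N C del: index_mult_mat(1))
  hence "(t - s) * (\<Sum>i<D. (C x t * C x s * N u) $$ (i, i))
      = ?a * (\<Sum>i<D. (C x s * N u) $$ (i, i)) - ?b * (\<Sum>i<D. (C x t * N u) $$ (i, i))"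
    unfolding sum_distrib_left sum_subtractf[symmetric] by (intro sum.cong) auto
  thus ?thesis
    unfolding dir_deriv_trace by (simp add: diff_divide_distrib mult.commute)
qed

lemma H_polynomial:
  "i < D \<Longrightarrow> j < D \<Longrightarrow> real_polynomial_function (\<lambda>x. H x m $$ (i, j))"
proof (induction m arbitrary: i j)
  case 0
  thus ?case by (auto simp: H_def)
next
  case (Suc m)
  have "H x (Suc m) $$ (i, j) = coeff (line_poly p x e) (d - m) * (if i = j then 1 else 0)
      + (\<Sum>r<D. (- 1) * N x $$ (i, r) * H x m $$ (r, j))" for x
  proof -
    have "H x (Suc m) $$ (i, j) = coeff (line_poly p x e) (d - m) * (if i = j then 1 else 0)
        + (- N x * H x m) $$ (i, j)"
      using Suc.prems carrier_matD[OF uminus_N(1)[of x]] carrier_matD[OF H_carrier[of x m]]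
      by (simp add: H_def del: index_mult_mat(1) uminus_mult_left_mat)
    also have "(- N x * H x m) $$ (i, j) = (\<Sum>r<D. (- 1) * N x $$ (i, r) * H x m $$ (r, j))"
      unfolding mult_mat_entry[OF uminus_N(1) H_carrier Suc.prems]
      using Suc.prems carrier_matD[OF N_carrier[of x]] by (intro sum.cong) auto
    finally show ?thesis .
  qed
  thus ?case
    using Suc
    by (auto intro!: real_polynomial_function.intros(2-4) real_polynomial_function_sum
        coeff_line_poly_polynomial[OF homogeneous] N_polynomial)
qed

text \<open>A singular \<open>\<epsilon> I + N u\<close> with \<open>\<epsilon> > 0\<close> would give the negative zero \<open>- \<epsilon>\<close> of
  \<open>t \<mapsto> p (t e - u)\<close>.\<close>

lemma N_psd:
  assumes u: "u \<in> hyperbolicity_cone p e" and v: "v \<in> carrier_vec D"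
  shows "0 \<le> scalar_prod v (N u *\<^sub>v v)"
proof (rule psd_of_nonsingular_shifts[OF N_carrier N_symmetric _ v])
  fix \<epsilon> :: real assume \<epsilon>: "\<epsilon> > 0"
  show "Determinant.det (N u + \<epsilon> \<cdot>\<^sub>m 1\<^sub>m D) \<noteq> 0"
  proof
    assume "Determinant.det (N u + \<epsilon> \<cdot>\<^sub>m 1\<^sub>m D) = 0"
    moreover have "N u + \<epsilon> \<cdot>\<^sub>m 1\<^sub>m D = \<epsilon> \<cdot>\<^sub>m 1\<^sub>m D + N u"
      by (rule comm_add_mat[of _ D D]) auto
    ultimately have "p (u + \<epsilon> *\<^sub>R e) = 0" using det_rep[of u \<epsilon>] l_pos by simp
    hence "p ((- 1) *\<^sub>R (u + \<epsilon> *\<^sub>R e)) = 0"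
      unfolding homogeneous_polynomial_scale[OF homogeneous] by simp
    hence "poly (line_poly p (- u) e) (- \<epsilon>) = 0"
      unfolding poly_line_poly[OF homogeneous] by (simp add: scaleR_add_right)
    hence "complex_of_real (- \<epsilon>) \<in> line_zeros p (- u) e"
      unfolding line_zeros_def mem_Collect_eq of_real_hom.poly_map_poly by simp
    hence "complex_of_real (- \<epsilon>) \<in> \<real>\<^sub>\<ge>\<^sub>0"
      using u unfolding hyperbolicity_cone_def by blast
    thus False using \<epsilon> by (simp add: complex_nonneg_Reals_iff)
  qed
qed

lemma bezoutian_matrix_sos:
  assumes u: "u \<in> hyperbolicity_cone p e"
  shows "matrix_sos d (\<lambda>x. bezoutian d p e x u)"
proof -
  obtain L where L: "L \<in> carrier_mat D D" and NL: "N u = L * transpose_mat L"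
    using psd_factorization[OF N_carrier N_symmetric N_psd[OF u]] by blast
  define G where "G x i = H x (d - i) * L" for x i
  \<comment> \<open>Row \<open>i\<close> of \<open>Q x\<close> lists the \<open>D\<^sup>2\<close> entries of \<open>G x i\<close>, the coefficient of \<open>t ^ i\<close> in
    \<open>C x t L\<close>, divided by \<open>sqrt l\<close>.\<close>
  define Q where "Q x = mat d (D * D) (\<lambda>(i, k). G x i $$ (k div D, k mod D) / sqrt l)" for x
  have CL: "(C x t * L) $$ (a, b) = (\<Sum>i<d. G x i $$ (a, b) * t ^ i)" if "a < D" "b < D" for x t a b
  proof -
    have "(C x t * L) $$ (a, b) = (\<Sum>r<D. \<Sum>i<d. H x (d - i) $$ (a, r) * L $$ (r, b) * t ^ i)"
      unfolding mult_mat_entry[OF C_carrier L that] using that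
      by (intro sum.cong refl) (auto simp: C_entry sum_distrib_left sum_distrib_right mult_ac)
    also have "\<dots> = (\<Sum>i<d. G x i $$ (a, b) * t ^ i)"
      unfolding G_def mult_mat_entry[OF H_carrier L that] sum_distrib_right by (rule sum.swap)
    finally show ?thesis .
  qed
  have trace: "(\<Sum>i<D. (C x t * C x s * N u) $$ (i, i))
      = (\<Sum>a<D. \<Sum>b<D. (C x t * L) $$ (a, b) * (C x s * L) $$ (a, b))" for x t s
  proof -
    let ?V = "C x s * L"
    have V: "?V \<in> carrier_mat D D" using L by (rule mult_carrier_mat[OF C_carrier])
    have Lt: "transpose_mat L \<in> carrier_mat D D" using L by simp
    have sym: "C x t $$ (i, j) = C x t $$ (j, i)" if "i < D" "j < D" for i j
      using that C_symmetric[of x t] by (metis C_carrier carrier_matD index_transpose_mat(1))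
    have "C x t * C x s * N u = C x t * (?V * transpose_mat L)"
      unfolding NL assoc_mult_mat[OF C_carrier C_carrier mult_carrier_mat[OF L Lt]]
        assoc_mult_mat[OF C_carrier L Lt] ..
    hence "(\<Sum>i<D. (C x t * C x s * N u) $$ (i, i))
        = (\<Sum>i<D. \<Sum>a<D. \<Sum>b<D. C x t $$ (i, a) * (?V $$ (a, b) * L $$ (i, b)))"
      using L by (simp add: mult_mat_entry[OF C_carrier mult_carrier_mat[OF V Lt]]
          mult_mat_entry[OF V Lt] sum_distrib_left del: index_mult_mat(1))
    also have "\<dots> = (\<Sum>a<D. \<Sum>b<D. \<Sum>i<D. C x t $$ (i, a) * (?V $$ (a, b) * L $$ (i, b)))"
      by (subst sum.swap, subst (2) sum.swap) simp
    also have "\<dots> = (\<Sum>a<D. \<Sum>b<D. (C x t * L) $$ (a, b) * ?V $$ (a, b))"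
    proof (intro sum.cong refl, goal_cases)
      case (1 a b)
      hence ab: "a < D" "b < D" by auto
      show ?case
        unfolding mult_mat_entry[OF C_carrier[of x t] L ab] sum_distrib_right
        using ab by (intro sum.cong refl) (simp add: sym[of _ a] mult_ac del: index_mult_mat(1))
    qed
    finally show ?thesis .
  qed
  have entry: "(Q x * transpose_mat (Q x)) $$ (i, j) = (\<Sum>a<D. \<Sum>b<D. G x i $$ (a, b) * G x j $$ (a, b)) / l"
    if "i < d" "j < d" for x i j
  proof -
    have Qc: "Q x \<in> carrier_mat d (D * D)" by (simp add: Q_def)
    have "(Q x * transpose_mat (Q x)) $$ (i, j)
        = (\<Sum>k<D * D. G x i $$ (k div D, k mod D) * G x j $$ (k div D, k mod D) / l)"
      using that by (subst mult_mat_entry[OF Qc _ that]) (auto simp: Q_def intro!: sum.cong)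
    also have "\<dots> = (\<Sum>a<D. \<Sum>b<D. G x i $$ (a, b) * G x j $$ (a, b) / l)"
      by (rule sum_split_index)
    finally show ?thesis by (simp add: sum_divide_distrib)
  qed
  have "bezoutian d p e x u = Q x * transpose_mat (Q x)" for x
    unfolding bezoutian_def
  proof (rule the1_equality[OF bezoutian_welldefined[OF homogeneous]], intro conjI allI impI)
    show "Q x * transpose_mat (Q x) \<in> carrier_mat d d"
      by (rule mult_carrier_mat[of _ d "D * D"]) (simp_all add: Q_def)
    fix t s :: real assume "t \<noteq> s"
    hence "(p (x + t *\<^sub>R e) * dir_deriv u p (x + s *\<^sub>R e)
          - dir_deriv u p (x + t *\<^sub>R e) * p (x + s *\<^sub>R e)) / (t - s)
        = (\<Sum>a<D. \<Sum>b<D. (C x t * L) $$ (a, b) * (C x s * L) $$ (a, b)) / l"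
      by (simp add: bezout_trace trace)
    also have "(\<Sum>a<D. \<Sum>b<D. (C x t * L) $$ (a, b) * (C x s * L) $$ (a, b))
        = (\<Sum>a<D. \<Sum>b<D. \<Sum>i<d. \<Sum>j<d. G x i $$ (a, b) * t ^ i * (G x j $$ (a, b) * s ^ j))"
      by (intro sum.cong refl) (simp add: CL sum_product del: index_mult_mat(1))
    also have "\<dots> = (\<Sum>a<D. \<Sum>i<d. \<Sum>j<d. \<Sum>b<D. G x i $$ (a, b) * t ^ i * (G x j $$ (a, b) * s ^ j))"
      by (subst sum.swap, subst (2) sum.swap) simp
    also have "\<dots> = (\<Sum>i<d. \<Sum>j<d. \<Sum>a<D. \<Sum>b<D. G x i $$ (a, b) * t ^ i * (G x j $$ (a, b) * s ^ j))"
      by (subst sum.swap, subst (2) sum.swap) simp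
    also have "\<dots> / l = (\<Sum>i<d. \<Sum>j<d. (Q x * transpose_mat (Q x)) $$ (i, j) * t ^ i * s ^ j)"
      unfolding sum_divide_distrib
    proof (intro sum.cong refl, goal_cases)
      case (1 i j)
      hence "i < d" "j < d" by auto
      thus ?case
        by (simp add: entry sum_distrib_left sum_distrib_right sum_divide_distrib mult_ac del: index_mult_mat(1))
    qed
    finally show "(p (x + t *\<^sub>R e) * dir_deriv u p (x + s *\<^sub>R e)
          - dir_deriv u p (x + t *\<^sub>R e) * p (x + s *\<^sub>R e)) / (t - s)
        = (\<Sum>i<d. \<Sum>j<d. (Q x * transpose_mat (Q x)) $$ (i, j) * t ^ i * s ^ j)" .
  qed
  moreover have "real_polynomial_function (\<lambda>x. Q x $$ (i, k))" if "i < d" "k < D * D" for i k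
  proof -
    have "D > 0" using that by (cases D) auto
    hence lt: "k div D < D" "k mod D < D"
      using that by (auto simp: less_mult_imp_div_less)
    have "Q x $$ (i, k) = (\<Sum>r<D. H x (d - i) $$ (k div D, r) * (L $$ (r, k mod D) / sqrt l))" for x
      using that lt by (simp add: Q_def G_def mult_mat_entry[OF H_carrier L] sum_divide_distrib
          del: index_mult_mat(1))
    thus ?thesis
      using lt by (auto intro!: real_polynomial_function.intros(2,4) real_polynomial_function_sum H_polynomial)
  qed
  moreover have "Q x \<in> carrier_mat d (D * D)" for x by (simp add: Q_def)
  ultimately show ?thesis unfolding matrix_sos_def by blast
qed

end

section \<open>Powers with a definite determinantal representation\<close>

lemma linear_pencil_add_scale:
  "linear_pencil D A (x + h *\<^sub>R u) = linear_pencil D A x + h \<cdot>\<^sub>m linear_pencil D A u"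
  by (intro eq_matI)
    (auto simp: linear_pencil_def algebra_simps sum.distrib sum_distrib_left)

lemma linear_pencil_carrier [simp]: "linear_pencil D A x \<in> carrier_mat D D"
  by (simp add: linear_pencil_def)

theorem proposition4p7:
  fixes p :: "real^'n \<Rightarrow> real" and e :: "real^'n" and d :: nat
  assumes "p \<in> hyperbolic_polys d e"
    and "\<exists>l::nat. l > 0 \<and> definite_det_rep (d * l) e (\<lambda>x. p x ^ l)"
  shows "sos_hyperbolic d p e"
proof -
  have homogeneous: "homogeneous_polynomial d p"
    using assms(1) by (simp add: hyperbolic_polys_def)
  obtain l A where l: "l > 0"
    and A_carrier: "\<And>i. A i \<in> carrier_mat (d * l) (d * l)"
    and A_symmetric: "\<And>i. transpose_mat (A i) = A i"
    and det: "\<And>x. p x ^ l = Determinant.det (linear_pencil (d * l) A x)"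
    and pos_def: "pos_def_mat (d * l) (linear_pencil (d * l) A e)"
    using assms(2) unfolding definite_det_rep_def by blast
  define D where "D = d * l"
  define M where "M = linear_pencil D A"
  have M: "M x \<in> carrier_mat D D" for x by (simp add: M_def)
  have M_symmetric: "transpose_mat (M x) = M x" for x
  proof -
    have "A i $$ (j, k) = A i $$ (k, j)" if "j < D" "k < D" for i j k
      using that A_carrier[of i] A_symmetric[of i] unfolding D_def
      by (metis carrier_matD index_transpose_mat(1))
    thus ?thesis by (intro eq_matI) (auto simp: M_def linear_pencil_def intro!: sum.cong)
  qed
  have "0 \<le> scalar_prod v (M e *\<^sub>v v)" if "v \<in> carrier_vec D" for v
  proof (cases "v = 0\<^sub>v D")
    case True
    thus ?thesis using M[of e] by simp
  next
    case False
    thus ?thesis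
      using pos_def that unfolding pos_def_mat_def M_def D_def by (blast intro: less_imp_le)
  qed
  then obtain K where K: "K \<in> carrier_mat D D" and MK: "M e = K * transpose_mat K"
    using psd_factorization[OF M M_symmetric] by blast
  have Kt: "transpose_mat K \<in> carrier_mat D D" using K by simp
  have "Determinant.det (M e) \<noteq> 0"
    using det[of e, symmetric] assms(1) unfolding hyperbolic_polys_def M_def D_def by simp
  hence "Determinant.det K \<noteq> 0"
    unfolding MK det_mult[OF K Kt] by simp
  then obtain X where X: "X \<in> carrier_mat D D" "K * X = 1\<^sub>m D" "X * K = 1\<^sub>m D"
    using inverse_of_nonzero_det[OF K] by metis
  have Xt: "transpose_mat X \<in> carrier_mat D D" using X by simp
  have det_X: "Determinant.det X \<noteq> 0"
    using det_mult[OF X(1) K] unfolding X(3) by auto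
  \<comment> \<open>The congruence by \<open>X\<close>, the inverse of \<open>K\<close>, takes \<open>M e = K K\<^sup>T\<close> to the identity.\<close>
  define N where "N x = X * M x * transpose_mat X" for x
  have XM: "X * M x \<in> carrier_mat D D" for x using X(1) M by simp
  have N: "N x \<in> carrier_mat D D" for x unfolding N_def by (rule mult_carrier_mat[OF XM Xt])
  have N_affine: "N (x + h *\<^sub>R u) = N x + h \<cdot>\<^sub>m N u" for x h u
    unfolding N_def M_def linear_pencil_add_scale
    unfolding M_def[symmetric] mult_add_distrib_mat[OF X(1) M smult_carrier_mat[OF M]]
      mult_smult_distrib[OF X(1) M] add_mult_distrib_mat[OF XM smult_carrier_mat[OF XM] Xt]
      mult_smult_assoc_mat[OF XM Xt] ..
  have N_e: "N e = 1\<^sub>m D"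
  proof -
    have "X * M e = transpose_mat K"
      unfolding MK assoc_mult_mat[OF X(1) K Kt, symmetric] X(3) by (rule left_mult_one_mat[OF Kt])
    hence "N e = transpose_mat (X * K)"
      unfolding N_def by (simp add: transpose_mult[OF X(1) K])
    thus ?thesis unfolding X(3) by simp
  qed
  interpret normalized_det_rep p e d l D N "1 / (Determinant.det X)\<^sup>2"
  proof
    show "transpose_mat (N x) = N x" for x
      unfolding N_def transpose_mult[OF XM Xt] transpose_mult[OF X(1) M] M_symmetric transpose_transpose
      by (rule assoc_mult_mat[OF X(1) M Xt, symmetric])
    show "real_polynomial_function (\<lambda>x. N x $$ (i, j))" if "i < D" "j < D" for i j
    proof -
      have "N x $$ (i, j) = (\<Sum>s<D. (\<Sum>r<D. X $$ (i, r) * (\<Sum>k\<in>UNIV. A k $$ (r, s) * (x $h k))) * X $$ (j, s))" for x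
        unfolding N_def mult_mat_entry[OF XM Xt that]
      proof (intro sum.cong refl, goal_cases)
        case (1 s)
        hence s: "s < D" by simp
        show ?case
          unfolding mult_mat_entry[OF X(1) M that(1) s]
          using s that(2) X(1) by (simp add: M_def linear_pencil_def)
      qed
      thus ?thesis
        by (auto intro!: real_polynomial_function.intros(2,4) real_polynomial_function_sum
            real_polynomial_function.intros(1)[OF bounded_linear_vec_nth])
    qed
    show "p (x + t *\<^sub>R e) ^ l = 1 / (Determinant.det X)\<^sup>2 * Determinant.det (t \<cdot>\<^sub>m 1\<^sub>m D + N x)" for x t
    proof -
      have "t \<cdot>\<^sub>m 1\<^sub>m D + N x = N (x + t *\<^sub>R e)"
        unfolding N_affine N_e by (rule comm_add_mat[OF _ N]) simp
      also have "Determinant.det \<dots> = (Determinant.det X)\<^sup>2 * Determinant.det (M (x + t *\<^sub>R e))"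
        unfolding N_def det_mult[OF XM Xt] det_mult[OF X(1) M] det_transpose[OF X(1)]
        by (simp add: power2_eq_square mult_ac)
      also have "Determinant.det (M (x + t *\<^sub>R e)) = p (x + t *\<^sub>R e) ^ l"
        unfolding det M_def D_def ..
      finally show ?thesis using det_X by simp
    qed
  qed (use homogeneous l det_X N N_affine in auto)
  show ?thesis
    unfolding sos_hyperbolic_def using assms(1) bezoutian_matrix_sos by blast
qed

end
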